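(* Let $G$ be a finitely generated group with $0<\operatorname{asdim} G<\infty$. Then $G$ can be weakly coarsely separated by a set $Y$ with $\operatorname{asdim} Y<\operatorname{asdim} G$.
   Context: Asymptotic dimension: for a metric space $X$ and an integer $n\ge 0$, $\operatorname{asdim} X\le n$ iff for every $R>0$ there is a uniformly bounded covering $\mathcal U$ of $X$ (i.e. $\sup_{U\in\mathcal U}\operatorname{diam}U<\infty$) such that every ball of radius $R$ in $X$ intersects at most $n+1$ elements of $\mathcal U$. Subsets carry the restricted metric. For a finitely generated group $G$, $\operatorname{asdim}G$ is the asymptotic dimension of a Cayley graph $\operatorname{Cay}(G,S)$ ($S$ a finite generating set) with its graph metric; it does not depend on $S$. For $A\subseteq X$, $N_R(A)$ is the set of points of $X$ at distance at most $R$ from $A$. Weak coarse separation: let $X$ be a metric space and $K\subseteq X$. Here a component of $X\setminus N_R(K)$ means a nonempty union of connected components of $X\setminus N_R(K)$ (so it need not be connected). A component $C$ of $X\setminus N_R(K)$ is deep if $C$ is not contained in $N_{R'}(K)$ for any $R'>0$. The set $K$ weakly coarsely separates $X$ if there is an $R>0$ such that $X\setminus N_R(K)$ contains at least two disjoint deep components, at least one of which is connected. A finitely generated group $G$ can be weakly coarsely separated by a set $Y$ if there exists a finite generating set $S$ of $G$ such that $Y\subseteq \operatorname{Cay}(G,S)$ and $Y$ weakly coarsely separates $\operatorname{Cay}(G,S)$. *)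

theory Defs
  imports "HOL-Analysis.Analysis" "HOL-Algebra.Generated_Groups" "HOL-Library.Extended_Nat"
begin

section \<open>Asymptotic dimension\<close>

definition uniformly_bounded_cover :: "'a metric \<Rightarrow> 'a set set \<Rightarrow> bool" where
  "uniformly_bounded_cover X \<U> \<longleftrightarrow>
     \<Union>\<U> = mspace X \<and> (\<exists>D. \<forall>U\<in>\<U>. \<forall>x\<in>U. \<forall>y\<in>U. mdist X x y \<le> D)"

definition asdim_le :: "'a metric \<Rightarrow> nat \<Rightarrow> bool" where
  "asdim_le X n \<longleftrightarrow>
     (\<forall>R>0. \<exists>\<U>. uniformly_bounded_cover X \<U> \<and>
        (\<forall>x\<in>mspace X. finite {U\<in>\<U>. U \<inter> mball_of X x R \<noteq> {}} \<and>
                       card {U\<in>\<U>. U \<inter> mball_of X x R \<noteq> {}} \<le> n + 1))"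

text \<open>The infimum of the empty set in \<^typ>\<open>enat\<close> is \<open>\<infinity>\<close>; the empty space gets the value \<open>0\<close>.\<close>

definition asdim :: "'a metric \<Rightarrow> enat" where
  "asdim X = Inf {enat n | n. asdim_le X n}"

lemma asdim_le_mono: "asdim_le X m \<Longrightarrow> m \<le> n \<Longrightarrow> asdim_le X n"
  unfolding asdim_le_def by (meson add_le_mono1 order_trans)

lemma asdim_le_iff: "asdim X \<le> enat n \<longleftrightarrow> asdim_le X n"
proof
  assume "asdim_le X n"
  then show "asdim X \<le> enat n"
    unfolding asdim_def by (intro Inf_lower) auto
next
  assume le: "asdim X \<le> enat n"
  let ?A = "{enat n | n. asdim_le X n}"
  have "?A \<noteq> {}"
    using le by (auto simp: asdim_def Inf_enat_def split: if_splits)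
  then have "Inf ?A \<in> ?A"
    unfolding Inf_enat_def by (auto intro: LeastI)
  then obtain m where "Inf ?A = enat m" "asdim_le X m"
    by auto
  then show "asdim_le X n"
    using le asdim_le_mono unfolding asdim_def by fastforce
qed

section \<open>Weak coarse separation\<close>

text \<open>Distance to a set is the infimum distance, and the empty set is at infinite distance
  from every point.\<close>

definition coarse_nbhd :: "'a metric \<Rightarrow> real \<Rightarrow> 'a set \<Rightarrow> 'a set" where
  "coarse_nbhd X R A = {x \<in> mspace X. A \<noteq> {} \<and> (INF a\<in>A. mdist X x a) \<le> R}"

text \<open>Components are nonempty unions of connected components, so they need not be connected.\<close>

definition component_of_complement :: "'a metric \<Rightarrow> 'a set \<Rightarrow> real \<Rightarrow> 'a set \<Rightarrow> bool" where
  "component_of_complement X K R C \<longleftrightarrow>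
     C \<noteq> {} \<and>
     (\<exists>\<C>. \<C> \<subseteq> connected_components_of
                 (subtopology (mtopology_of X) (mspace X - coarse_nbhd X R K)) \<and>
           C = \<Union>\<C>)"

definition deep :: "'a metric \<Rightarrow> 'a set \<Rightarrow> 'a set \<Rightarrow> bool" where
  "deep X K C \<longleftrightarrow> (\<forall>R'>0. \<not> C \<subseteq> coarse_nbhd X R' K)"

definition weakly_coarsely_separates :: "'a metric \<Rightarrow> 'a set \<Rightarrow> bool" where
  "weakly_coarsely_separates X K \<longleftrightarrow>
     K \<subseteq> mspace X \<and>
     (\<exists>R>0. \<exists>C D.
        component_of_complement X K R C \<and> deep X K C \<and>
        component_of_complement X K R D \<and> deep X K D \<and>
        C \<inter> D = {} \<and>
        (connectedin (mtopology_of X) C \<or> connectedin (mtopology_of X) D))"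

section \<open>Cayley graphs as metric graphs\<close>

definition finite_generating_set :: "('a, 'b) monoid_scheme \<Rightarrow> 'a set \<Rightarrow> bool" where
  "finite_generating_set G S \<longleftrightarrow> finite S \<and> S \<subseteq> carrier G \<and> generate G S = carrier G"

definition finitely_generated :: "('a, 'b) monoid_scheme \<Rightarrow> bool" where
  "finitely_generated G \<longleftrightarrow> (\<exists>S. finite_generating_set G S)"

text \<open>The simple graph: no loops and no multiple edges. The set \<open>S\<close> need not be symmetric.\<close>

definition cayley_adj :: "('a, 'b) monoid_scheme \<Rightarrow> 'a set \<Rightarrow> 'a \<Rightarrow> 'a \<Rightarrow> bool" where
  "cayley_adj G S g h \<longleftrightarrow>
     g \<in> carrier G \<and> h \<in> carrier G \<and> g \<noteq> h \<and>
     (\<exists>s\<in>S. h = g \<otimes>\<^bsub>G\<^esub> s \<or> g = h \<otimes>\<^bsub>G\<^esub> s)"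

text \<open>Points of the geometric realization are given by their barycentric coordinates.\<close>

definition vertex_pt :: "'a \<Rightarrow> 'a \<Rightarrow> real" where
  "vertex_pt g = (\<lambda>v. if v = g then 1 else 0)"

definition edge_seg :: "'a \<Rightarrow> 'a \<Rightarrow> ('a \<Rightarrow> real) set" where
  "edge_seg g h = {x. \<exists>t\<in>{0..1}. x = (\<lambda>v. (1 - t) * vertex_pt g v + t * vertex_pt h v)}"

definition cayley_points :: "('a, 'b) monoid_scheme \<Rightarrow> 'a set \<Rightarrow> ('a \<Rightarrow> real) set" where
  "cayley_points G S =
     vertex_pt ` carrier G \<union> \<Union>{edge_seg g h | g h. cayley_adj G S g h}"

text \<open>\<open>pl_path G S x l y\<close>: a piecewise linear path of length \<open>l\<close> leads from \<open>x\<close> to \<open>y\<close>. Each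
  piece lies in one closed edge \<open>{g, h}\<close>, which has length one and on which the distance of two
  points is the difference of their \<open>g\<close>-coordinates.\<close>

inductive pl_path ::
  "('a, 'b) monoid_scheme \<Rightarrow> 'a set \<Rightarrow> ('a \<Rightarrow> real) \<Rightarrow> real \<Rightarrow> ('a \<Rightarrow> real) \<Rightarrow> bool"
  for G S where
  refl: "x \<in> cayley_points G S \<Longrightarrow> pl_path G S x 0 x"
| step: "pl_path G S x l y \<Longrightarrow> cayley_adj G S g h \<Longrightarrow> y \<in> edge_seg g h \<Longrightarrow> z \<in> edge_seg g h
         \<Longrightarrow> pl_path G S x (l + \<bar>y g - z g\<bar>) z"

text \<open>The value \<open>0\<close> off the carrier is only there because \<^locale>\<open>Metric_space\<close> asks for a total
  nonnegative symmetric function.\<close>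

definition cayley_dist ::
  "('a, 'b) monoid_scheme \<Rightarrow> 'a set \<Rightarrow> ('a \<Rightarrow> real) \<Rightarrow> ('a \<Rightarrow> real) \<Rightarrow> real" where
  "cayley_dist G S x y =
     (if x \<in> cayley_points G S \<and> y \<in> cayley_points G S then Inf {l. pl_path G S x l y} else 0)"

text \<open>Meaningful only if \<open>S\<close> generates \<open>G\<close>, see \<open>Metric_space_cayley\<close> below.\<close>

definition cayley_graph :: "('a, 'b) monoid_scheme \<Rightarrow> 'a set \<Rightarrow> ('a \<Rightarrow> real) metric" where
  "cayley_graph G S = metric (cayley_points G S, cayley_dist G S)"

text \<open>The asymptotic dimension of a Cayley graph of a finitely generated group does not depend on
  the finite generating set, so an arbitrary one is chosen.\<close>

definition group_asdim :: "('a, 'b) monoid_scheme \<Rightarrow> enat" where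
  "group_asdim G = asdim (cayley_graph G (SOME S. finite_generating_set G S))"

lemma vertex_pt_edge_seg: "vertex_pt g \<in> edge_seg g h" "vertex_pt h \<in> edge_seg g h"
  unfolding edge_seg_def by (force intro: bexI[of _ 0], force intro: bexI[of _ 1])

lemma edge_seg_points: "cayley_adj G S g h \<Longrightarrow> edge_seg g h \<subseteq> cayley_points G S"
  unfolding cayley_points_def by auto

lemma edge_seg_coord_le:
  assumes "y \<in> edge_seg g h" "z \<in> edge_seg g h" "g \<noteq> h"
  shows "\<bar>y v - z v\<bar> \<le> \<bar>y g - z g\<bar>"
proof -
  obtain t s where "y = (\<lambda>v. (1 - t) * vertex_pt g v + t * vertex_pt h v)"
    and "z = (\<lambda>v. (1 - s) * vertex_pt g v + s * vertex_pt h v)"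
    using assms unfolding edge_seg_def by auto
  then show ?thesis using \<open>g \<noteq> h\<close> by (auto simp: vertex_pt_def)
qed

lemma pl_path_points:
  "pl_path G S x l y \<Longrightarrow> x \<in> cayley_points G S \<and> y \<in> cayley_points G S"
  by (induction rule: pl_path.induct) (auto dest: subsetD[OF edge_seg_points])

lemma pl_path_coord_le: "pl_path G S x l y \<Longrightarrow> \<bar>x v - y v\<bar> \<le> l"
proof (induction rule: pl_path.induct)
  case (step x l y g h z)
  then have "\<bar>y v - z v\<bar> \<le> \<bar>y g - z g\<bar>"
    by (intro edge_seg_coord_le) (auto simp: cayley_adj_def)
  with step.IH show ?case by linarith
qed simp

lemma pl_path_nonneg: "pl_path G S x l y \<Longrightarrow> 0 \<le> l"
  by (induction rule: pl_path.induct) auto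

lemma pl_path_trans:
  assumes "pl_path G S y m z" "pl_path G S x l y"
  shows "pl_path G S x (l + m) z"
  using assms
proof (induction rule: pl_path.induct)
  case (step y m u g h z)
  then show ?case using pl_path.step[of G S x "l + m" u g h z] by (simp add: add.assoc)
qed simp

lemma pl_path_edge:
  assumes "cayley_adj G S g h" "y \<in> edge_seg g h" "z \<in> edge_seg g h"
  shows "pl_path G S y \<bar>y g - z g\<bar> z"
  using pl_path.step[OF pl_path.refl assms] edge_seg_points assms by fastforce

lemma pl_path_sym: "pl_path G S x l y \<Longrightarrow> pl_path G S y l x"
proof (induction rule: pl_path.induct)
  case (step x l y g h z)
  have "pl_path G S z \<bar>z g - y g\<bar> y"
    using step.hyps by (intro pl_path_edge)
  from pl_path_trans[OF step.IH this] show ?case by (simp add: abs_minus_commute add.commute)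
qed (rule pl_path.refl)

lemma pl_path_vertices:
  assumes "group G" "S \<subseteq> carrier G" "w \<in> generate G S" "a \<in> carrier G"
  shows "\<exists>l. pl_path G S (vertex_pt a) l (vertex_pt (a \<otimes>\<^bsub>G\<^esub> w))"
proof -
  interpret group G by fact
  have adj: "\<exists>l. pl_path G S (vertex_pt g) l (vertex_pt h)"
    if "g \<in> carrier G" "h \<in> carrier G" "\<exists>s\<in>S. h = g \<otimes>\<^bsub>G\<^esub> s \<or> g = h \<otimes>\<^bsub>G\<^esub> s" for g h
  proof (cases "g = h")
    case True
    then show ?thesis using that pl_path.refl[of "vertex_pt g" G S]
      by (auto simp: cayley_points_def)
  next
    case False
    then have "cayley_adj G S g h" using that by (simp add: cayley_adj_def)
    from pl_path_edge[OF this vertex_pt_edge_seg] show ?thesis by blast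
  qed
  show ?thesis using assms(3,4)
  proof (induction arbitrary: a rule: generate.induct)
    case one
    then show ?case using pl_path.refl[of "vertex_pt a" G S]
      by (auto simp: cayley_points_def)
  next
    case (incl s)
    then show ?case using assms(2) by (intro adj) auto
  next
    case (inv s)
    then show ?case using assms(2) by (intro adj bexI[of _ s]) (auto simp: m_assoc)
  next
    case (eng u w)
    have "u \<in> carrier G" "w \<in> carrier G"
      using eng.hyps assms(2) generate_in_carrier by blast+
    moreover obtain l where "pl_path G S (vertex_pt a) l (vertex_pt (a \<otimes>\<^bsub>G\<^esub> u))"
      using eng by blast
    moreover obtain m where
      "pl_path G S (vertex_pt (a \<otimes>\<^bsub>G\<^esub> u)) m (vertex_pt (a \<otimes>\<^bsub>G\<^esub> u \<otimes>\<^bsub>G\<^esub> w))"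
      using eng \<open>u \<in> carrier G\<close> by blast
    ultimately show ?case using pl_path_trans eng.prems by (metis m_assoc)
  qed
qed

lemma pl_path_exists:
  assumes "group G" "finite_generating_set G S"
    and "x \<in> cayley_points G S" "y \<in> cayley_points G S"
  shows "\<exists>l. pl_path G S x l y"
proof -
  interpret group G by fact
  have vert: "\<exists>g\<in>carrier G. \<exists>l. pl_path G S x l (vertex_pt g)"
    if x: "x \<in> cayley_points G S" for x
  proof (cases "x \<in> vertex_pt ` carrier G")
    case True
    then show ?thesis using pl_path.refl[OF x] by blast
  next
    case False
    then obtain g h where "cayley_adj G S g h" "x \<in> edge_seg g h"
      using x unfolding cayley_points_def by auto
    then show ?thesis
      using pl_path_edge[of G S g h x "vertex_pt g"] vertex_pt_edge_seg
      by (metis cayley_adj_def)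
  qed
  obtain g k h l where gh: "g \<in> carrier G" "h \<in> carrier G"
    and p: "pl_path G S x k (vertex_pt g)" "pl_path G S y l (vertex_pt h)"
    using vert assms(3,4) by metis
  have "inv\<^bsub>G\<^esub> g \<otimes>\<^bsub>G\<^esub> h \<in> generate G S" "g \<otimes>\<^bsub>G\<^esub> (inv\<^bsub>G\<^esub> g \<otimes>\<^bsub>G\<^esub> h) = h"
    using gh assms(2) by (auto simp: finite_generating_set_def m_assoc[symmetric])
  then obtain m where "pl_path G S (vertex_pt g) m (vertex_pt h)"
    using pl_path_vertices[OF assms(1)] gh assms(2) unfolding finite_generating_set_def by metis
  then show ?thesis using p pl_path_trans pl_path_sym by metis
qed

lemma Metric_space_cayley:
  assumes "group G" "finite_generating_set G S"
  shows "Metric_space (cayley_points G S) (cayley_dist G S)"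
proof -
  let ?P = "cayley_points G S" and ?L = "\<lambda>x y. {l. pl_path G S x l y}"
  have bdd: "bdd_below (?L x y)" for x y
    using pl_path_nonneg by (intro bdd_belowI[of _ 0]) auto
  have ne: "?L x y \<noteq> {}" if "x \<in> ?P" "y \<in> ?P" for x y
    using pl_path_exists[OF assms that] by auto
  have coord: "\<bar>x v - y v\<bar> \<le> Inf (?L x y)" if "x \<in> ?P" "y \<in> ?P" for x y v
    using ne[OF that] pl_path_coord_le by (intro cInf_greatest) auto
  show ?thesis
  proof
    show "0 \<le> cayley_dist G S x y" for x y
    proof (cases "x \<in> ?P \<and> y \<in> ?P")
      case True
      then have "0 \<le> Inf (?L x y)"
        using ne pl_path_nonneg by (intro cInf_greatest) auto
      with True show ?thesis by (simp add: cayley_dist_def)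
    qed (auto simp: cayley_dist_def)
    have "?L x y = ?L y x" for x y
      using pl_path_sym by blast
    then show "cayley_dist G S x y = cayley_dist G S y x" for x y
      unfolding cayley_dist_def by simp
  next
    fix x y assume xy: "x \<in> ?P" "y \<in> ?P"
    show "cayley_dist G S x y = 0 \<longleftrightarrow> x = y"
    proof
      assume "cayley_dist G S x y = 0"
      then have "\<bar>x v - y v\<bar> \<le> 0" for v
        using coord[OF xy, of v] xy by (simp add: cayley_dist_def)
      then show "x = y" by (auto simp: fun_eq_iff)
    next
      assume "x = y"
      then have "0 \<in> ?L x y" using pl_path.refl[OF xy(1)] by simp
      then have "Inf (?L x y) \<le> 0" using bdd by (rule cInf_lower)
      moreover have "0 \<le> Inf (?L x y)"
        using ne[OF xy] pl_path_nonneg by (intro cInf_greatest) auto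
      ultimately show "cayley_dist G S x y = 0" using xy by (simp add: cayley_dist_def)
    qed
  next
    fix x y z assume xyz: "x \<in> ?P" "y \<in> ?P" "z \<in> ?P"
    have "Inf (?L x z) - m \<le> l" if "l \<in> ?L x y" "m \<in> ?L y z" for l m
      using cInf_lower[OF _ bdd, of "l + m" x z] pl_path_trans that by fastforce
    then have "Inf (?L x z) - m \<le> Inf (?L x y)" if "m \<in> ?L y z" for m
      using ne[OF xyz(1,2)] that by (intro cInf_greatest) auto
    then have "Inf (?L x z) - Inf (?L x y) \<le> m" if "m \<in> ?L y z" for m
      using that by force
    then have "Inf (?L x z) - Inf (?L x y) \<le> Inf (?L y z)"
      using ne[OF xyz(2,3)] by (intro cInf_greatest) auto
    then show "cayley_dist G S x z \<le> cayley_dist G S x y + cayley_dist G S y z"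
      using xyz by (simp add: cayley_dist_def)
  qed
qed

lemma cayley_graph_simps:
  assumes "group G" "finite_generating_set G S"
  shows "mspace (cayley_graph G S) = cayley_points G S"
    and "mdist (cayley_graph G S) = cayley_dist G S"
  unfolding cayley_graph_def
  using Metric_space.mspace_metric Metric_space.mdist_metric Metric_space_cayley[OF assms] by blast+

end

theory Submission
  imports Defs
begin

text \<open>
  Let \<open>n\<close> be the asymptotic dimension of the Cayley graph. For a cover of multiplicity \<open>n + 1\<close> at a
  large scale, let \<open>Z\<^sub>k\<close> be the set of points whose \<open>k\<close>-ball meets \<open>n + 1\<close> members. At that scale
  \<open>Z\<^sub>k\<close> splits into uniformly bounded, widely separated classes, and a set that meets every \<open>Z\<^sub>k\<close>
  in a bounded set has asymptotic dimension at most \<open>n - 1\<close>. Because the classes are separated, a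
  ball of radius \<open>i\<close> can be enlarged by a bounded amount to a set \<open>W\<^sub>i\<close> whose boundary avoids
  \<open>Z\<^sub>j\<close> for all \<open>j < i\<close>. The boundary \<open>Y\<close> of \<open>W = \<Union>\<^sub>i W\<^sub>i\<close> then meets each \<open>Z\<^sub>k\<close> only in the
  bounded set \<open>W\<^sub>0 \<union> \<dots> \<union> W\<^sub>k\<close>. The group being infinite, there is a bi-infinite geodesic; the
  balls are placed along one of its halves, so sparsely that \<open>W\<close> diverges from the other half. This
  other half lies in a connected deep component outside \<open>W\<close>, while the centres of the growing balls
  make the part inside \<open>W\<close> deep.
\<close>

section \<open>Sets of smaller asymptotic dimension in a metric space\<close>

definition bounded_at :: "'a metric \<Rightarrow> 'a \<Rightarrow> 'a set \<Rightarrow> bool" where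
  "bounded_at X a A \<longleftrightarrow> (\<exists>B. \<forall>x\<in>A. mdist X a x \<le> B)"

text \<open>The bound is a free \<open>m\<close> rather than \<open>n + 1\<close>, so that a drop of
  the multiplicity by one can be stated without subtraction.\<close>

definition cover_multiplicity_le :: "'a metric \<Rightarrow> real \<Rightarrow> nat \<Rightarrow> 'a set set \<Rightarrow> bool" where
  "cover_multiplicity_le X R m \<U> \<longleftrightarrow>
     (\<forall>x\<in>mspace X. finite {U\<in>\<U>. U \<inter> mball_of X x R \<noteq> {}} \<and>
                    card {U\<in>\<U>. U \<inter> mball_of X x R \<noteq> {}} \<le> m)"

lemma asdim_le_iff_multiplicity:
  "asdim_le X n \<longleftrightarrow>
     (\<forall>R>0. \<exists>\<U>. uniformly_bounded_cover X \<U> \<and> cover_multiplicity_le X R (n + 1) \<U>)"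
  unfolding asdim_le_def cover_multiplicity_le_def by simp

lemma cover_multiplicity_le_mono:
  assumes "cover_multiplicity_le X R m \<U>" "R' \<le> R"
  shows "cover_multiplicity_le X R' m \<U>"
  unfolding cover_multiplicity_le_def
proof
  fix x assume x: "x \<in> mspace X"
  have mball_mono: "mball_of X x R' \<subseteq> mball_of X x R" using assms(2) by auto
  have sub: "{U\<in>\<U>. U \<inter> mball_of X x R' \<noteq> {}} \<subseteq> {U\<in>\<U>. U \<inter> mball_of X x R \<noteq> {}}"
    using mball_mono by blast
  have "finite {U\<in>\<U>. U \<inter> mball_of X x R \<noteq> {}}" "card {U\<in>\<U>. U \<inter> mball_of X x R \<noteq> {}} \<le> m"
    using assms(1) x unfolding cover_multiplicity_le_def by blast+
  then show "finite {U\<in>\<U>. U \<inter> mball_of X x R' \<noteq> {}} \<and>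
             card {U\<in>\<U>. U \<inter> mball_of X x R' \<noteq> {}} \<le> m"
    using finite_subset[OF sub] card_mono[OF _ sub] by linarith
qed

text \<open>All members of the cover that come near the bounded set \<open>P\<close> are merged into one, so that
  balls centred in \<open>P\<close> meet a single member of the new cover.\<close>

lemma merge_cover_near_bounded_set:
  assumes cov: "uniformly_bounded_cover X \<U>"
    and a: "a \<in> mspace X" and Y: "Y \<subseteq> mspace X" and "P \<subseteq> Y"
    and bdd: "bounded_at X a P"
    and n: "1 \<le> n"
    and few: "\<And>y. y \<in> Y - P \<Longrightarrow> finite {U\<in>\<U>. U \<inter> mball_of X y k \<noteq> {}} \<and>
                              card {U\<in>\<U>. U \<inter> mball_of X y k \<noteq> {}} \<le> n"
  shows "\<exists>\<V>. uniformly_bounded_cover (submetric X Y) \<V> \<and>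
             cover_multiplicity_le (submetric X Y) k n \<V>"
proof -
  obtain D where UN: "\<Union>\<U> = mspace X" and "\<forall>U\<in>\<U>. \<forall>x\<in>U. \<forall>y\<in>U. mdist X x y \<le> D"
    using cov unfolding uniformly_bounded_cover_def by (elim conjE exE)
  then have D: "mdist X x y \<le> D" if "U \<in> \<U>" "x \<in> U" "y \<in> U" for U x y
    using that by simp
  obtain B where B: "\<And>x. x \<in> P \<Longrightarrow> mdist X a x \<le> B"
    using bdd unfolding bounded_at_def by blast
  define near where "near U \<longleftrightarrow> (\<exists>x\<in>P. U \<inter> mball_of X x k \<noteq> {})" for U
  define V0 where "V0 = Y \<inter> \<Union>{U\<in>\<U>. near U}"
  define merge where "merge U = (if near U then V0 else U \<inter> Y)" for U
  have V0d: "mdist X a y \<le> B + k + D" if y: "y \<in> V0" for y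
  proof -
    obtain U x z where U: "U \<in> \<U>" "y \<in> U" "x \<in> P" "z \<in> U" and z: "z \<in> mball_of X x k"
      using y unfolding V0_def near_def by blast
    have xyz: "x \<in> mspace X" "y \<in> mspace X" "z \<in> mspace X" "mdist X x z < k"
      using z U(1,2) UN by auto
    have "mdist X z y \<le> D" "mdist X a x \<le> B" using D[OF U(1,4,2)] B[OF U(3)] .
    then show ?thesis
      using mdist_triangle[OF a xyz(1,2)] mdist_triangle[OF xyz(1,3,2)] xyz(4) by linarith
  qed
  \<comment> \<open>If \<open>P\<close> is empty, \<open>B\<close> is arbitrary, so neither bound
    need dominate the other; their maximum is taken below.\<close>
  have diam: "mdist X x y \<le> 2 * (B + k + D) \<or> mdist X x y \<le> D" if "U \<in> \<U>" "x \<in> merge U" "y \<in> merge U" for U x y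
  proof (cases "near U")
    case True
    then have "x \<in> V0" "y \<in> V0" using that by (auto simp: merge_def)
    then have "x \<in> mspace X" "y \<in> mspace X" using Y by (auto simp: V0_def)
    then show ?thesis using V0d[OF \<open>x \<in> V0\<close>] V0d[OF \<open>y \<in> V0\<close>] mdist_triangle[of x X a y] a
      by (simp add: mdist_commute)
  next
    case False
    then show ?thesis using that D by (auto simp: merge_def)
  qed
  have "mdist X x y \<le> max (2 * (B + k + D)) D"
    if V: "V \<in> merge ` \<U>" and xy: "x \<in> V" "y \<in> V" for V x y
  proof -
    obtain U where "U \<in> \<U>" "V = merge U" using V by blast
    then show ?thesis using xy diam[of U x y] by auto
  qed
  moreover have "\<Union>(merge ` \<U>) = Y"
  proof
    show "\<Union>(merge ` \<U>) \<subseteq> Y" by (auto simp: merge_def V0_def split: if_splits)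
    show "Y \<subseteq> \<Union>(merge ` \<U>)"
    proof
      fix y assume "y \<in> Y"
      then obtain U where "U \<in> \<U>" "y \<in> U" using UN Y by blast
      then have "y \<in> merge U" using \<open>y \<in> Y\<close> by (auto simp: merge_def V0_def)
      then show "y \<in> \<Union>(merge ` \<U>)" using \<open>U \<in> \<U>\<close> by blast
    qed
  qed
  ultimately have 1: "uniformly_bounded_cover (submetric X Y) (merge ` \<U>)"
    using Y unfolding uniformly_bounded_cover_def mspace_submetric mdist_submetric
    by (intro conjI exI[of _ "max (2 * (B + k + D)) D"] ballI) (simp_all add: Int_absorb2)
  have 2: "cover_multiplicity_le (submetric X Y) k n (merge ` \<U>)"
    unfolding cover_multiplicity_le_def
  proof
    fix y assume "y \<in> mspace (submetric X Y)"
    then have y: "y \<in> Y" by simp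
    let ?A = "{U\<in>\<U>. U \<inter> mball_of X y k \<noteq> {}}"
    let ?B = "{V\<in>merge ` \<U>. V \<inter> mball_of (submetric X Y) y k \<noteq> {}}"
    have sub: "?B \<subseteq> merge ` ?A"
    proof
      fix V assume "V \<in> ?B"
      then obtain U z where U: "U \<in> \<U>" "V = merge U" and z: "z \<in> V" "z \<in> mball_of X y k"
        unfolding in_mball_of mspace_submetric mdist_submetric by fastforce
      show "V \<in> merge ` ?A"
      proof (cases "near U")
        case True
        \<comment> \<open>\<open>U\<close> itself need not meet the ball of \<open>y\<close>; some
          near member containing \<open>z\<close> does, and it merges into the same set.\<close>
        then obtain U' where "U' \<in> \<U>" "near U'" "z \<in> U'"
          using U z by (auto simp: merge_def V0_def)
        then have "U' \<in> ?A" "merge U' = V" using z U True by (auto simp: merge_def)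
        then show ?thesis by blast
      next
        case False
        then have "U \<in> ?A" using z U by (auto simp: merge_def)
        then show ?thesis using U by blast
      qed
    qed
    show "finite ?B \<and> card ?B \<le> n"
    proof (cases "y \<in> P")
      case True
      then have "merge ` ?A \<subseteq> {V0}" by (auto simp: merge_def near_def)
      then have "?B \<subseteq> {V0}" by (rule order_trans[OF sub])
      then have "finite ?B" "card ?B \<le> card {V0}"
        by (rule finite_subset[OF _ finite.insertI[OF finite.emptyI]],
            rule card_mono[OF finite.insertI[OF finite.emptyI]])
      then show ?thesis using n by simp
    next
      case False
      then have A: "finite ?A" "card ?A \<le> n" using few[of y] y by simp_all
      have "card ?B \<le> card (merge ` ?A)" using A sub by (intro card_mono) simp_all
      also have "\<dots> \<le> n" using card_image_le[OF A(1)] A(2) by (rule order_trans)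
      finally show ?thesis using finite_subset[OF sub] A(1) by simp
    qed
  qed
  show ?thesis using 1 2 by blast
qed

text \<open>\<open>Z\<close> is the set of points whose \<open>k\<close>-ball meets the maximal number \<open>n + 1\<close> of members of a
  cover that has multiplicity \<open>n + 1\<close> at the larger scale \<open>k + r\<close>. Two points of \<open>Z\<close> at distance
  at most \<open>r\<close> must meet the same members; hence \<open>Z\<close> has dimension zero at scale \<open>r\<close>, the classes
  being given by \<open>c\<close>, while the dimension drops away from \<open>Z\<close>.\<close>

lemma asdim_layer:
  assumes asd: "asdim_le X n" and n: "1 \<le> n" and "0 \<le> k" "0 < r"
  shows "\<exists>Z (c :: 'a \<Rightarrow> 'a set set) E. Z \<subseteq> mspace X \<and> 0 \<le> E \<and>
     (\<forall>x\<in>Z. \<forall>y\<in>Z. mdist X x y \<le> r \<longrightarrow> c x = c y) \<and>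
     (\<forall>x\<in>Z. \<forall>y\<in>Z. c x = c y \<longrightarrow> mdist X x y \<le> E) \<and>
     (\<forall>a\<in>mspace X. \<forall>Y\<subseteq>mspace X. bounded_at X a (Y \<inter> Z) \<longrightarrow>
        (\<exists>\<V>. uniformly_bounded_cover (submetric X Y) \<V> \<and>
             cover_multiplicity_le (submetric X Y) k n \<V>))"
proof -
  obtain \<U> where cov: "uniformly_bounded_cover X \<U>"
    and mul: "cover_multiplicity_le X (k + r) (n + 1) \<U>"
    using asd assms(3,4) unfolding asdim_le_iff_multiplicity by (metis add_nonneg_pos)
  obtain D where UN: "\<Union>\<U> = mspace X" and "\<forall>U\<in>\<U>. \<forall>x\<in>U. \<forall>y\<in>U. mdist X x y \<le> D"
    using cov unfolding uniformly_bounded_cover_def by (elim conjE exE)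
  then have D: "mdist X x y \<le> D" if "U \<in> \<U>" "x \<in> U" "y \<in> U" for U x y
    using that by simp
  define c where "c x = {U\<in>\<U>. U \<inter> mball_of X x k \<noteq> {}}" for x
  define Z where "Z = {x\<in>mspace X. card (c x) = n + 1}"
  have mulk: "finite (c x)" "card (c x) \<le> n + 1" if "x \<in> mspace X" for x
    using cover_multiplicity_le_mono[OF mul, of k] assms(4) that
    unfolding cover_multiplicity_le_def c_def by auto
  have Z: "Z \<subseteq> mspace X" unfolding Z_def by auto
  have c_eq: "c x = c y" if xy: "x \<in> Z" "y \<in> Z" "mdist X x y \<le> r" for x y
  proof -
    let ?L = "{U\<in>\<U>. U \<inter> mball_of X x (k + r) \<noteq> {}}"
    have X: "x \<in> mspace X" "y \<in> mspace X" using xy by (auto simp: Z_def)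
    have "mball_of X x k \<subseteq> mball_of X x (k + r)" using assms(4) by auto
    moreover have "mball_of X y k \<subseteq> mball_of X x (k + r)"
    proof
      fix w assume "w \<in> mball_of X y k"
      then show "w \<in> mball_of X x (k + r)"
        using X xy(3) mdist_triangle[of x X y w] by auto
    qed
    ultimately have sub: "c x \<subseteq> ?L" "c y \<subseteq> ?L" unfolding c_def by blast+
    have L: "finite ?L" "card ?L \<le> n + 1"
      using mul X unfolding cover_multiplicity_le_def by blast+
    \<comment> \<open>Both sets have \<open>n + 1\<close> elements and lie in \<open>?L\<close>,
      which has at most that many.\<close>
    have "c x = ?L" "c y = ?L"
      using sub L xy card_seteq[of ?L "c x"] card_seteq[of ?L "c y"] by (auto simp: Z_def)
    then show ?thesis by simp
  qed
  \<comment> \<open>A common member links the two points. The absolute value secures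
    \<open>0 \<le> E\<close>, since nothing makes \<open>D\<close> nonnegative when all members are
    empty.\<close>
  have c_diam: "mdist X x y \<le> 2 * k + \<bar>D\<bar>" if xy: "x \<in> Z" "y \<in> Z" "c x = c y" for x y
  proof -
    have X: "x \<in> mspace X" "y \<in> mspace X" using xy by (auto simp: Z_def)
    have "c x \<noteq> {}" using xy by (auto simp: Z_def)
    then obtain U where "U \<in> c x" "U \<in> c y" using xy by auto
    then obtain u v where "u \<in> U" "u \<in> mball_of X x k" "v \<in> U" "v \<in> mball_of X y k" "U \<in> \<U>"
      unfolding c_def by blast
    then show ?thesis
      using D[of U u v] X mdist_triangle[of x X u y] mdist_triangle[of u X v y]
      by (auto simp: mdist_commute)
  qed
  \<comment> \<open>Off \<open>Z\<close> a \<open>k\<close>-ball meets at most \<open>n\<close>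
    members already, so only the members near the bounded set \<open>Y \<inter> Z\<close> have to be
    merged.\<close>
  have drop: "\<exists>\<V>. uniformly_bounded_cover (submetric X Y) \<V> \<and>
             cover_multiplicity_le (submetric X Y) k n \<V>"
    if "a \<in> mspace X" "Y \<subseteq> mspace X" "bounded_at X a (Y \<inter> Z)" for a Y
  proof (rule merge_cover_near_bounded_set[OF cov that(1,2) _ that(3) n])
    show "Y \<inter> Z \<subseteq> Y" by simp
    fix y assume "y \<in> Y - Y \<inter> Z"
    then have "y \<in> mspace X" "card (c y) \<noteq> n + 1" using that by (auto simp: Z_def)
    then show "finite {U\<in>\<U>. U \<inter> mball_of X y k \<noteq> {}} \<and>
               card {U\<in>\<U>. U \<inter> mball_of X y k \<noteq> {}} \<le> n"
      using mulk[of y] unfolding c_def by linarith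
  qed
  show ?thesis
  proof (intro exI[of _ Z] exI[of _ c] exI[of _ "2 * k + \<bar>D\<bar>"] conjI ballI allI impI)
    show "0 \<le> 2 * k + \<bar>D\<bar>" using assms(3) by simp
  qed (fact Z c_eq c_diam drop)+
qed

section \<open>Saturation of sets with respect to the layers\<close>

text \<open>\<open>E k r\<close> bounds the diameter of the classes of layer \<open>k\<close> at
  scale \<open>r\<close>. A step from \<open>k\<close> to \<open>k + 1\<close> costs
  \<open>s k\<close> to reach a class, its diameter to cross it, 1 for its neighbourhood, and
  \<open>s k\<close> again for the lower layers. The scale \<open>1 + s k\<close> of layer
  \<open>k\<close> depends on lower layers only, so the recursion is well founded.\<close>

fun saturation_radius :: "(nat \<Rightarrow> real \<Rightarrow> real) \<Rightarrow> nat \<Rightarrow> real" where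
  "saturation_radius E 0 = 0"
| "saturation_radius E (Suc k) =
     2 * saturation_radius E k + 1 + E k (1 + saturation_radius E k)"

lemma saturation_radius_nonneg:
  assumes "\<And>k r. 0 < r \<Longrightarrow> 0 \<le> E k r"
  shows "0 \<le> saturation_radius E k"
  by (induction k) (auto intro!: assms add_nonneg_nonneg)

text \<open>First all classes of \<open>Z k\<close> that come within \<open>s k\<close> of \<open>A\<close> are added together with their
  \<open>1\<close>-neighbourhoods, and then the result is saturated for the lower layers. That second step moves
  points by at most \<open>s k\<close>, so it reaches no further class of \<open>Z k\<close>, as classes are more than
  \<open>1 + s k\<close> apart.\<close>

lemma saturated_superset:
  fixes X :: "'a metric" and c :: "nat \<Rightarrow> 'a \<Rightarrow> 'b" and E :: "nat \<Rightarrow> real \<Rightarrow> real"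
  defines "s \<equiv> saturation_radius E"
  assumes E: "\<And>k r. 0 < r \<Longrightarrow> 0 \<le> E k r"
    and Z: "\<And>k. Z k \<subseteq> mspace X"
    and sep: "\<And>k x y. x \<in> Z k \<Longrightarrow> y \<in> Z k \<Longrightarrow> mdist X x y \<le> 1 + s k \<Longrightarrow> c k x = c k y"
    and bdd: "\<And>k x y. x \<in> Z k \<Longrightarrow> y \<in> Z k \<Longrightarrow> c k x = c k y \<Longrightarrow> mdist X x y \<le> E k (1 + s k)"
    and A: "A \<subseteq> mspace X"
  shows "\<exists>W. A \<subseteq> W \<and> W \<subseteq> mspace X \<and> (\<forall>w\<in>W. \<exists>a\<in>A. mdist X a w \<le> s k) \<and>
             (\<forall>j<k. \<forall>z\<in>Z j \<inter> W. \<forall>x\<in>mspace X. mdist X z x \<le> 1 \<longrightarrow> x \<in> W)"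
  using A
proof (induction k arbitrary: A)
  case 0
  have "mdist X w w = 0" if "w \<in> A" for w
    using that 0 by auto
  then have "\<exists>a\<in>A. mdist X a w \<le> s 0" if "w \<in> A" for w
    using that by (intro bexI[of _ w]) (auto simp: s_def)
  then show ?case using 0 by (intro exI[of _ A]) auto
next
  case (Suc k)
  have s0: "0 \<le> s k" unfolding s_def by (rule saturation_radius_nonneg[OF E])
  define H where "H = {z\<in>Z k. \<exists>z'\<in>Z k. c k z = c k z' \<and> (\<exists>a\<in>A. mdist X a z' \<le> s k)}"
  define A' where "A' = A \<union> {x\<in>mspace X. \<exists>z\<in>H. mdist X z x \<le> 1}"
  have "A' \<subseteq> mspace X" using Suc.prems by (auto simp: A'_def)
  from Suc.IH[OF this] obtain W where W: "A' \<subseteq> W" "W \<subseteq> mspace X"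
    and near: "\<And>w. w \<in> W \<Longrightarrow> \<exists>a\<in>A'. mdist X a w \<le> s k"
    and sat: "\<And>j z x. j < k \<Longrightarrow> z \<in> Z j \<inter> W \<Longrightarrow> x \<in> mspace X \<Longrightarrow> mdist X z x \<le> 1 \<Longrightarrow> x \<in> W"
    by blast
  have near': "\<exists>a\<in>A. mdist X a x \<le> s k + E k (1 + s k) + 1" if "x \<in> A'" for x
  proof (cases "x \<in> A")
    case True
    then have "mdist X x x = 0" using Suc.prems by auto
    then show ?thesis using True s0 E[of "1 + s k" k] by (intro bexI[of _ x]) auto
  next
    case False
    then obtain z z' a where x: "x \<in> mspace X" "mdist X z x \<le> 1" "a \<in> A"
      and z: "z \<in> Z k" "z' \<in> Z k" "c k z = c k z'" and a: "mdist X a z' \<le> s k"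
      using \<open>x \<in> A'\<close> by (auto simp: A'_def H_def)
    have "mdist X z' z \<le> E k (1 + s k)" using bdd z by simp
    moreover have "a \<in> mspace X" "z \<in> mspace X" "z' \<in> mspace X" using x z Z Suc.prems by auto
    ultimately show ?thesis
      using x a mdist_triangle[of a X z' x] mdist_triangle[of z' X z x]
      by (intro bexI[of _ a]) auto
  qed
  have "\<exists>a\<in>A. mdist X a w \<le> s (Suc k)" if "w \<in> W" for w
  proof -
    obtain a' where a': "a' \<in> A'" "mdist X a' w \<le> s k" using near \<open>w \<in> W\<close> by blast
    then obtain a where a: "a \<in> A" "mdist X a a' \<le> s k + E k (1 + s k) + 1" using near' by blast
    have "a \<in> mspace X" "a' \<in> mspace X" "w \<in> mspace X"
      using a a' W \<open>w \<in> W\<close> Suc.prems by auto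
    then show ?thesis
      using a a' mdist_triangle[of a X a' w] by (intro bexI[of _ a]) (auto simp: s_def)
  qed
  moreover have "x \<in> W" if "j < Suc k" "z \<in> Z j \<inter> W" "x \<in> mspace X" "mdist X z x \<le> 1" for j z x
  proof (cases "j = k")
    case True
    then have z: "z \<in> Z k" "z \<in> W" "z \<in> mspace X" using that Z by auto
    \<comment> \<open>If \<open>a\<close> lies in \<open>A\<close>, the class of \<open>z\<close>
      was added at once. Otherwise \<open>a\<close> is within 1 of some \<open>h\<close> in
      \<open>H\<close>, and \<open>h\<close> and \<open>z\<close> are at most \<open>1 + s k\<close>
      apart, hence in the same class.\<close>
    obtain a where a: "a \<in> A'" "mdist X a z \<le> s k" using near z by blast
    have "z \<in> H"
    proof (cases "a \<in> A")
      case True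
      then show ?thesis using z a by (auto simp: H_def)
    next
      case False
      then obtain h where h: "h \<in> H" "mdist X h a \<le> 1" "a \<in> mspace X"
        using a by (auto simp: A'_def)
      then have "h \<in> Z k" by (simp add: H_def)
      moreover have "h \<in> mspace X" using calculation Z by blast
      ultimately have "c k h = c k z"
        using h a z Z mdist_triangle[of h X a z] by (intro sep) auto
      then show ?thesis using h z by (auto simp: H_def)
    qed
    then show ?thesis using W that by (auto simp: A'_def)
  next
    case False
    then show ?thesis using sat that by (metis less_SucE)
  qed
  moreover have "A \<subseteq> W" using W by (auto simp: A'_def)
  ultimately show ?case using W by (intro exI[of _ W]) auto
qed

section \<open>Collars and their asymptotic dimension\<close>

text \<open>A coarse inner boundary. Its scale 1 is that of the saturation: a layer point whose unit
  ball stays in \<open>W\<close> is not in the collar.\<close>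

definition collar :: "'a metric \<Rightarrow> 'a set \<Rightarrow> 'a set" where
  "collar X W = {w\<in>W. \<exists>v\<in>mspace X - W. mdist X w v \<le> 1}"

text \<open>The point outside \<open>W\<close> that is within 1 of \<open>y\<close> has distance
  more than \<open>r\<close> from \<open>a\<close>.\<close>

lemma collar_dist_ge:
  assumes "a \<in> mspace X" "W \<subseteq> mspace X" "\<And>x. x \<in> mspace X \<Longrightarrow> mdist X a x \<le> r \<Longrightarrow> x \<in> W"
    and y: "y \<in> collar X W"
  shows "r - 1 \<le> mdist X a y"
proof -
  obtain v where v: "v \<in> mspace X" "v \<notin> W" "mdist X y v \<le> 1" and "y \<in> mspace X"
    using y assms(2) unfolding collar_def by blast
  then have "mdist X a v \<le> mdist X a y + mdist X y v" using assms(1) by (auto intro: mdist_triangle)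
  moreover have "r < mdist X a v" using assms(3)[of v] v by force
  ultimately show ?thesis using v by linarith
qed

text \<open>The \<open>i\<close>-ball about \<open>p (t i)\<close> is saturated for the layers below
  \<open>i\<close>, and \<open>W\<close> is the union of the results. Centring at index
  \<open>t i\<close> instead of \<open>i\<close> makes the index of the centre bound the extent of
  the set, which later keeps \<open>W\<close> away from the other half of the geodesic.\<close>

lemma exists_set_with_small_collar:
  fixes X :: "'a metric" and p :: "nat \<Rightarrow> 'a"
  assumes asd: "asdim_le X n" and n: "1 \<le> n" and p: "\<And>t. p t \<in> mspace X"
  shows "\<exists>W t. W \<subseteq> mspace X \<and> (\<forall>i. \<forall>x\<in>mspace X. mdist X (p (t i)) x \<le> real i \<longrightarrow> x \<in> W) \<and>
     (\<forall>w\<in>W. \<exists>i. mdist X (p (t i)) w \<le> real (t i)) \<and>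
     asdim_le (submetric X (collar X W)) (n - 1)"
proof -
  define L where "L k r Z c E \<longleftrightarrow> Z \<subseteq> mspace X \<and> 0 \<le> E \<and>
     (\<forall>x\<in>Z. \<forall>y\<in>Z. mdist X x y \<le> r \<longrightarrow> c x = c y) \<and>
     (\<forall>x\<in>Z. \<forall>y\<in>Z. c x = c y \<longrightarrow> mdist X x y \<le> E) \<and>
     (\<forall>a\<in>mspace X. \<forall>Y\<subseteq>mspace X. bounded_at X a (Y \<inter> Z) \<longrightarrow>
        (\<exists>\<V>. uniformly_bounded_cover (submetric X Y) \<V> \<and>
             cover_multiplicity_le (submetric X Y) (real k) n \<V>))"
    for k :: nat and r Z E and c :: "'a \<Rightarrow> 'a set set"
  define P where "P k r T \<longleftrightarrow> L k r (fst T) (fst (snd T)) (snd (snd T))"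
    for k r and T :: "'a set \<times> ('a \<Rightarrow> 'a set set) \<times> real"
  \<comment> \<open>Layers are chosen for every scale \<open>r\<close> beforehand, because the scale
    \<open>1 + s k\<close> actually used is itself computed from the chosen bounds
    \<open>E\<close>.\<close>
  define T where "T k r = (SOME T. P k r T)" for k r
  define Z where "Z k r = fst (T k r)" for k r
  define c where "c k r = fst (snd (T k r))" for k r
  define E where "E k r = snd (snd (T k r))" for k r
  have all: "L k r (Z k r) (c k r) (E k r)" if "0 < r" for k r
  proof -
    have "\<exists>Z c E. L k r Z c E"
      unfolding L_def by (rule asdim_layer[OF asd n of_nat_0_le_iff that])
    then have "\<exists>T. P k r T" unfolding P_def by simp
    then have "P k r (T k r)" unfolding T_def by (rule someI_ex)
    then show ?thesis unfolding P_def Z_def c_def E_def .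
  qed
  define s where "s = saturation_radius E"
  define Z' where "Z' k = Z k (1 + s k)" for k
  have E: "0 \<le> E k r" if "0 < r" for k r
    using all[OF that, of k] unfolding L_def by (elim conjE)
  have s0: "0 \<le> s k" for k unfolding s_def using E by (rule saturation_radius_nonneg)
  then have pos: "0 < 1 + s k" for k by (simp add: add_pos_nonneg)
  have layer: "L k (1 + s k) (Z' k) (c k (1 + s k)) (E k (1 + s k))" for k
    unfolding Z'_def using pos by (rule all)
  have Z': "Z' k \<subseteq> mspace X" for k
    using layer[of k] unfolding L_def by (elim conjE)
  have "\<forall>x\<in>Z' k. \<forall>y\<in>Z' k. mdist X x y \<le> 1 + s k \<longrightarrow> c k (1 + s k) x = c k (1 + s k) y" for k
    using layer[of k] unfolding L_def by (elim conjE)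
  then have sep: "c k (1 + s k) x = c k (1 + s k) y"
    if "x \<in> Z' k" "y \<in> Z' k" "mdist X x y \<le> 1 + s k" for k x y
    using that by blast
  have "\<forall>x\<in>Z' k. \<forall>y\<in>Z' k. c k (1 + s k) x = c k (1 + s k) y \<longrightarrow> mdist X x y \<le> E k (1 + s k)" for k
    using layer[of k] unfolding L_def by (elim conjE)
  then have bdd: "mdist X x y \<le> E k (1 + s k)"
    if "x \<in> Z' k" "y \<in> Z' k" "c k (1 + s k) x = c k (1 + s k) y" for k x y
    using that by blast
  have "\<forall>a\<in>mspace X. \<forall>Y\<subseteq>mspace X. bounded_at X a (Y \<inter> Z' k) \<longrightarrow>
        (\<exists>\<V>. uniformly_bounded_cover (submetric X Y) \<V> \<and>
             cover_multiplicity_le (submetric X Y) (real k) n \<V>)" for k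
    using layer[of k] unfolding L_def by (elim conjE)
  then have drop: "\<exists>\<V>. uniformly_bounded_cover (submetric X Y) \<V> \<and>
                  cover_multiplicity_le (submetric X Y) (real k) n \<V>"
    if "a \<in> mspace X" "Y \<subseteq> mspace X" "bounded_at X a (Y \<inter> Z' k)" for a Y k
    using that by blast
  \<comment> \<open>\<open>W i\<close> reaches at most \<open>i + s i\<close> from its
    centre.\<close>
  define t where "t i = nat \<lceil>real i + s i\<rceil>" for i
  have t: "real i + s i \<le> real (t i)" for i unfolding t_def by linarith
  define A where "A i = {x\<in>mspace X. mdist X (p (t i)) x \<le> real i}" for i
  have "\<exists>W. A i \<subseteq> W \<and> W \<subseteq> mspace X \<and> (\<forall>w\<in>W. \<exists>a\<in>A i. mdist X a w \<le> s i) \<and>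
             (\<forall>j<i. \<forall>z\<in>Z' j \<inter> W. \<forall>x\<in>mspace X. mdist X z x \<le> 1 \<longrightarrow> x \<in> W)" for i
    unfolding s_def
  proof (rule saturated_superset[OF E Z', where c = "\<lambda>k. c k (1 + s k)"])
    show "A i \<subseteq> mspace X" unfolding A_def by blast
  qed (use sep bdd in \<open>simp_all only: s_def\<close>)
  then obtain W where W: "\<And>i. A i \<subseteq> W i \<and> W i \<subseteq> mspace X \<and> (\<forall>w\<in>W i. \<exists>a\<in>A i. mdist X a w \<le> s i) \<and>
             (\<forall>j<i. \<forall>z\<in>Z' j \<inter> W i. \<forall>x\<in>mspace X. mdist X z x \<le> 1 \<longrightarrow> x \<in> W i)"
    by metis
  have AW: "A i \<subseteq> W i" and WX: "W i \<subseteq> mspace X" for i using W by blast+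
  have Wt: "mdist X (p (t i)) w \<le> real (t i)" if w: "w \<in> W i" for i w
  proof -
    obtain a where a: "a \<in> A i" "mdist X a w \<le> s i" using W w by blast
    then have "a \<in> mspace X" "w \<in> mspace X" "mdist X (p (t i)) a \<le> real i"
      using WX w by (auto simp: A_def)
    then show ?thesis
      using mdist_triangle[of "p (t i)" X a w] p[of "t i"] a(2) t[of i] by linarith
  qed
  define V where "V = \<Union>(range W)"
  define Y where "Y = collar X V"
  have VX: "V \<subseteq> mspace X" unfolding V_def using WX by blast
  then have YX: "Y \<subseteq> mspace X" unfolding Y_def collar_def by blast
  \<comment> \<open>For \<open>k < i\<close> the set \<open>W i\<close> is saturated for layer
    \<open>k\<close>, so it would contain the point outside \<open>V\<close> that puts
    \<open>y\<close> into the collar.\<close>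
  have YZ: "\<exists>i\<le>k. y \<in> W i" if y: "y \<in> Y" "y \<in> Z' k" for y k
  proof -
    obtain i v where i: "y \<in> W i" and v: "v \<in> mspace X" "v \<notin> V" "mdist X y v \<le> 1"
      using y(1) unfolding Y_def collar_def V_def by blast
    have "\<not> k < i"
    proof
      assume "k < i"
      then have "v \<in> W i" using W i y(2) v by blast
      then show False using v unfolding V_def by blast
    qed
    then show ?thesis using i by (auto simp: not_less)
  qed
  have Ybdd: "bounded_at X (p 0) (Y \<inter> Z' k)" for k
    unfolding bounded_at_def
  proof (intro exI ballI)
    fix y assume "y \<in> Y \<inter> Z' k"
    then obtain i where i: "i \<le> k" "y \<in> W i" using YZ by blast
    then have "mdist X (p 0) y \<le> mdist X (p 0) (p (t i)) + mdist X (p (t i)) y"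
      using p WX by (intro mdist_triangle) auto
    also have "\<dots> \<le> mdist X (p 0) (p (t i)) + real (t i)" using Wt i by simp
    \<comment> \<open>The sum is a bound that no longer depends on which \<open>W i\<close> contains
      \<open>y\<close>.\<close>
    also have "\<dots> \<le> (\<Sum>i\<le>k. mdist X (p 0) (p (t i)) + real (t i))"
      using i by (intro member_le_sum) auto
    finally show "mdist X (p 0) y \<le> (\<Sum>i\<le>k. mdist X (p 0) (p (t i)) + real (t i))" .
  qed
  have "asdim_le (submetric X Y) (n - 1)"
    unfolding asdim_le_iff_multiplicity
  proof (intro allI impI)
    fix R :: real assume "0 < R"
    \<comment> \<open>Since the collar is bounded in every layer, a layer of index at least
      \<open>R\<close> may be used; its multiplicity bound \<open>n\<close> is
      \<open>n - 1 + 1\<close>.\<close>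
    obtain k where k: "R \<le> real k" using real_arch_simple by blast
    obtain \<V> where "uniformly_bounded_cover (submetric X Y) \<V>"
      "cover_multiplicity_le (submetric X Y) (real k) n \<V>"
      using drop[OF p YX Ybdd] by blast
    then show "\<exists>\<V>. uniformly_bounded_cover (submetric X Y) \<V> \<and>
                   cover_multiplicity_le (submetric X Y) R (n - 1 + 1) \<V>"
      using cover_multiplicity_le_mono[OF _ k] n by auto
  qed
  then show ?thesis
    using VX AW Wt unfolding Y_def
    by (intro exI[of _ V] exI[of _ t]) (fastforce simp: V_def A_def)
qed

section \<open>Weak coarse separation by a collar\<close>

lemma not_in_coarse_nbhdD:
  assumes "x \<in> mspace X" "x \<notin> coarse_nbhd X R A" "a \<in> A"
  shows "R < mdist X x a"
proof -
  have "(INF a\<in>A. mdist X x a) \<le> mdist X x a"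
    using assms(3) by (intro cINF_lower bdd_belowI2[of _ 0]) auto
  then show ?thesis using assms unfolding coarse_nbhd_def by fastforce
qed

text \<open>The margin \<open>c\<close> is there because an infimum of distances larger than
  \<open>R\<close> may equal \<open>R\<close>.\<close>

lemma not_in_coarse_nbhdI:
  assumes "\<And>a. a \<in> A \<Longrightarrow> c \<le> mdist X x a" "R < c"
  shows "x \<notin> coarse_nbhd X R A"
proof
  assume x: "x \<in> coarse_nbhd X R A"
  then have "A \<noteq> {}" by (simp add: coarse_nbhd_def)
  then have "c \<le> (INF a\<in>A. mdist X x a)" using assms(1) by (rule cINF_greatest)
  then show False using x assms(2) by (simp add: coarse_nbhd_def)
qed

text \<open>Away from the \<open>1\<close>-neighbourhood of the collar, both \<open>W\<close> and its complement contain with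
  each point the open unit ball around it.\<close>

lemma connected_avoiding_collar:
  assumes T: "connectedin (mtopology_of X) T" and W: "W \<subseteq> mspace X"
    and avoid: "T \<inter> coarse_nbhd X 1 (collar X W) = {}" and ne: "T \<inter> W \<noteq> {}"
  shows "T \<subseteq> W"
proof (rule ccontr)
  assume "\<not> T \<subseteq> W"
  \<comment> \<open>For \<open>A\<close> equal to \<open>W\<close> and to its complement these are
    open sets that together cover \<open>T\<close>; they would disconnect it.\<close>
  let ?E = "\<lambda>A. \<Union>x\<in>T \<inter> A. mball_of X x 1"
  have TX: "T \<subseteq> mspace X" using connectedin_subset_topspace[OF T] by simp
  have op: "openin (mtopology_of X) (?E A)" for A
    by (intro openin_Union) (auto simp: mtopology_of_def mball_of_def Metric_space.openin_mball[OF Metric_space_mspace_mdist])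
  have self: "x \<in> ?E A" if "x \<in> T" "x \<in> A" for x A
  proof (rule UN_I[of x])
    have "x \<in> mspace X" using that TX by blast
    then have "mdist X x x = 0" by simp
    then have "mdist X x x < 1" by linarith
    then show "x \<in> mball_of X x 1" using \<open>x \<in> mspace X\<close> by simp
  qed (use that in simp)
  have in_W: "y \<in> W" if x: "x \<in> T" "x \<in> W" and y: "y \<in> mspace X" "mdist X x y < 1" for x y
  proof (rule ccontr)
    assume "y \<notin> W"
    then have "x \<in> collar X W" using x y unfolding collar_def by force
    then have "1 < mdist X x x"
      using x TX avoid by (intro not_in_coarse_nbhdD[of x X 1 "collar X W"]) auto
    moreover have "mdist X x x = 0" using x TX by auto
    ultimately show False by linarith
  qed
  \<comment> \<open>Here \<open>y\<close>, not \<open>x\<close>, would be the collar point, and it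
    is less than 1 away from \<open>x\<close>.\<close>
  have notin_W: "y \<notin> W" if x: "x \<in> T" "x \<notin> W" and y: "y \<in> mspace X" "mdist X x y < 1" for x y
  proof
    assume "y \<in> W"
    then have "y \<in> collar X W" using x y TX unfolding collar_def by (force simp: mdist_commute)
    then have "1 < mdist X x y"
      using x TX avoid by (intro not_in_coarse_nbhdD[of x X 1 "collar X W"]) auto
    then show False using y by simp
  qed
  have "T \<subseteq> ?E W \<union> ?E (- W)" using self by blast
  moreover have "?E W \<inter> ?E (- W) \<inter> T = {}"
  proof -
    have "y \<in> W" if "y \<in> ?E W" for y using that in_W by auto
    moreover have "y \<notin> W" if "y \<in> ?E (- W)" for y using that notin_W by auto
    ultimately show ?thesis by blast
  qed
  moreover have "?E W \<inter> T \<noteq> {}" using ne self[of _ W] by blast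
  moreover have "?E (- W) \<inter> T \<noteq> {}" using \<open>\<not> T \<subseteq> W\<close> self[of _ "- W"] by blast
  ultimately show False by (intro connectedinD[OF T op[of W] op[of "- W"]])
qed

text \<open>At \<open>R = 1\<close> a connected component that meets \<open>W\<close> lies in
  \<open>W\<close>. The component \<open>C\<close> containing \<open>Q\<close> therefore avoids
  \<open>W\<close>, and the points \<open>q m\<close> make it deep. The other side is the union of
  all components meeting \<open>W\<close>, which the \<open>p i\<close> make deep.\<close>

lemma weakly_coarsely_separates_collar:
  assumes W: "W \<subseteq> mspace X"
    and p: "\<And>i. p i \<in> mspace X" "\<And>i x. x \<in> mspace X \<Longrightarrow> mdist X (p i) x \<le> real i \<Longrightarrow> x \<in> W"
    and Q: "connectedin (mtopology_of X) Q" "\<And>z w. z \<in> Q \<Longrightarrow> w \<in> W \<Longrightarrow> 2 \<le> mdist X z w"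
    and q: "\<And>m::nat. q m \<in> Q" "\<And>m w. w \<in> W \<Longrightarrow> real m \<le> mdist X (q m) w"
  shows "weakly_coarsely_separates X (collar X W)"
proof -
  let ?Y = "collar X W"
  let ?U = "mspace X - coarse_nbhd X 1 ?Y"
  let ?T = "subtopology (mtopology_of X) ?U"
  have YW: "?Y \<subseteq> W" unfolding collar_def by blast
  have QX: "Q \<subseteq> mspace X" using connectedin_subset_topspace[OF Q(1)] by simp
  have Q_far: "z \<notin> coarse_nbhd X 1 ?Y" if "z \<in> Q" for z
    using that Q(2) YW by (intro not_in_coarse_nbhdI[of ?Y 2]) auto
  then have QU: "Q \<subseteq> ?U" using QX by blast
  then have QT: "connectedin ?T Q" using Q(1) by (simp add: connectedin_subtopology)
  obtain C where C: "C \<in> connected_components_of ?T" "Q \<subseteq> C"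
  proof -
    have "?T \<noteq> trivial_topology"
      using QU QX q(1)[of 0] topspace_subtopology[of "mtopology_of X" ?U] by (metis IntI empty_iff subsetD topspace_discrete_topology topspace_mtopology_of)
    then show thesis using exists_connected_component_of_superset[OF QT] that by blast
  qed
  have conn: "connectedin (mtopology_of X) K \<and> K \<subseteq> ?U" if "K \<in> connected_components_of ?T" for K
    using connectedin_connected_components_of[OF that] by (simp add: connectedin_subtopology)
  have inside: "K \<subseteq> W" if K: "K \<in> connected_components_of ?T" "K \<inter> W \<noteq> {}" for K
    using conn[OF K(1)] K(2) by (intro connected_avoiding_collar[OF _ W]) blast+
  have disj: "C \<inter> W = {}"
  proof (rule ccontr)
    assume "C \<inter> W \<noteq> {}"
    then have "q 0 \<in> W" using inside[OF C(1)] C(2) q(1)[of 0] by blast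
    then have "2 \<le> mdist X (q 0) (q 0)" using Q(2) q(1) by blast
    moreover have "mdist X (q 0) (q 0) = 0" using QX q(1)[of 0] by auto
    ultimately show False by simp
  qed
  \<comment> \<open>The points \<open>p i\<close> may lie in different components. Weak separation
    allows one side to be disconnected, so all of them are collected.\<close>
  define \<D> where "\<D> = {K\<in>connected_components_of ?T. K \<inter> W \<noteq> {}}"
  have DW: "\<Union>\<D> \<subseteq> W" unfolding \<D>_def using inside by blast
  have p_far: "real i - 1 \<le> mdist X (p i) y" if "y \<in> ?Y" for i y
    using collar_dist_ge[OF p(1) W p(2) that] .
  \<comment> \<open>From \<open>i = 3\<close> on, the collar is at least
    \<open>i - 1 \<ge> 2\<close> away from \<open>p i\<close>, so \<open>p i\<close> survives the
    removal of the 1-neighbourhood.\<close>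
  have pD: "p i \<in> \<Union>\<D>" if "3 \<le> i" for i
  proof -
    have "2 \<le> mdist X (p i) y" if "y \<in> ?Y" for y
      using p_far[OF that, of i] \<open>3 \<le> i\<close> by linarith
    then have "p i \<notin> coarse_nbhd X 1 ?Y" by (intro not_in_coarse_nbhdI[of ?Y 2]) simp_all
    then have "p i \<in> \<Union>(connected_components_of ?T)"
      using p(1) by (simp add: Union_connected_components_of)
    then obtain K where "K \<in> connected_components_of ?T" "p i \<in> K" by blast
    moreover have "mdist X (p i) (p i) = 0" using p(1) by simp
    then have "p i \<in> W" using p(2)[OF p(1), of i i] by linarith
    ultimately show ?thesis unfolding \<D>_def by blast
  qed
  have "component_of_complement X ?Y 1 C"
    unfolding component_of_complement_def
    using C nonempty_connected_components_of[OF C(1)] by (intro conjI exI[of _ "{C}"]) auto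
  moreover have "deep X ?Y C"
    unfolding deep_def
  proof (intro allI impI notI)
    fix R :: real assume sub: "C \<subseteq> coarse_nbhd X R ?Y"
    obtain m :: nat where m: "R < real m" using reals_Archimedean2 by blast
    have "q m \<notin> coarse_nbhd X R ?Y"
      using q(2) YW m by (intro not_in_coarse_nbhdI[of ?Y "real m"]) auto
    then show False using sub C(2) q(1) by blast
  qed
  moreover have "component_of_complement X ?Y 1 (\<Union>\<D>)"
    unfolding component_of_complement_def
    using pD[of 3] by (intro conjI exI[of _ \<D>]) (auto simp: \<D>_def)
  moreover have "deep X ?Y (\<Union>\<D>)"
    unfolding deep_def
  proof (intro allI impI notI)
    fix R :: real assume sub: "\<Union>\<D> \<subseteq> coarse_nbhd X R ?Y"
    obtain m :: nat where m: "R < real m" using reals_Archimedean2 by blast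
    have "R < real (m + 3) - 1" using m by simp
    with p_far have "p (m + 3) \<notin> coarse_nbhd X R ?Y" by (rule not_in_coarse_nbhdI)
    moreover have "p (m + 3) \<in> \<Union>\<D>" by (rule pD) simp
    ultimately show False using sub by blast
  qed
  moreover have "C \<inter> \<Union>\<D> = {}" using disj DW by blast
  moreover have "connectedin (mtopology_of X) C" using conn[OF C(1)] by blast
  moreover have "?Y \<subseteq> mspace X" using YW W by blast
  ultimately show ?thesis
    unfolding weakly_coarsely_separates_def
    by (intro conjI exI[of _ "1::real"] exI[of _ C] exI[of _ "\<Union>\<D>"] disjI1) simp_all
qed

text \<open>The points \<open>p i\<close> run along one half of a geodesic line, \<open>Q\<close> is
  the other half and \<open>q\<close> runs along \<open>Q\<close>. Every point of \<open>W\<close>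
  lies in some \<open>t i\<close>-ball about \<open>p (t i)\<close>, while the distance from
  \<open>p (t i)\<close> to \<open>Q\<close> exceeds \<open>t i\<close>.\<close>

lemma exists_separating_set_of_smaller_asdim:
  fixes X :: "'a metric" and p q :: "nat \<Rightarrow> 'a"
  assumes asd: "asdim_le X n" and n: "1 \<le> n"
    and p: "\<And>i. p i \<in> mspace X"
    and Q: "connectedin (mtopology_of X) Q" "\<And>i z. z \<in> Q \<Longrightarrow> real i + 2 \<le> mdist X (p i) z"
    and q: "\<And>m. q m \<in> Q" "\<And>i m. real i + real m \<le> mdist X (p i) (q m)"
  shows "\<exists>Y\<subseteq>mspace X. weakly_coarsely_separates X Y \<and> asdim_le (submetric X Y) (n - 1)"
proof -
  obtain W t where W: "W \<subseteq> mspace X" "\<forall>i. \<forall>x\<in>mspace X. mdist X (p (t i)) x \<le> real i \<longrightarrow> x \<in> W"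
    "\<forall>w\<in>W. \<exists>i. mdist X (p (t i)) w \<le> real (t i)"
    and dim: "asdim_le (submetric X (collar X W)) (n - 1)"
    using exists_set_with_small_collar[of X n p, OF asd n p] by (elim exE conjE)
  have QX: "Q \<subseteq> mspace X" using connectedin_subset_topspace[OF Q(1)] by simp
  \<comment> \<open>The index cancels against the radius of the ball. The case \<open>a = 2\<close>
    separates \<open>Q\<close> from \<open>W\<close>, the case \<open>a = m\<close> makes
    \<open>q m\<close> diverge from \<open>W\<close>.\<close>
  have gap: "a \<le> mdist X z w"
    if "z \<in> Q" "w \<in> W" and far: "\<And>i. real i + a \<le> mdist X (p i) z" for z w a
  proof -
    obtain i where i: "mdist X (p (t i)) w \<le> real (t i)" using W(3) \<open>w \<in> W\<close> by blast
    have "mdist X (p (t i)) z \<le> mdist X (p (t i)) w + mdist X w z"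
      using p that W(1) QX by (intro mdist_triangle) auto
    then show ?thesis using i far[of "t i"] by (simp add: mdist_commute)
  qed
  have "weakly_coarsely_separates X (collar X W)"
  proof (rule weakly_coarsely_separates_collar[OF W(1), where p = "\<lambda>i. p (t i)" and q = q])
    show "x \<in> W" if "x \<in> mspace X" "mdist X (p (t i)) x \<le> real i" for i x
      using that W(2) by blast
    show "2 \<le> mdist X z w" if "z \<in> Q" "w \<in> W" for z w
      using gap[OF that Q(2)[OF that(1)]] .
    show "real m \<le> mdist X (q m) w" if "w \<in> W" for m w
      using gap[OF q(1) that q(2)] .
  qed (use p Q q in simp_all)
  moreover have "collar X W \<subseteq> mspace X" using W(1) unfolding collar_def by blast
  ultimately show ?thesis using dim by blast
qed

section \<open>Geodesic lines in Cayley graphs\<close>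

text \<open>The whole space is a cover by one member. Conversely, positive dimension forces the
  Cayley graph to be unbounded.\<close>

lemma asdim_le_0_of_bounded:
  assumes "\<And>x y. x \<in> mspace X \<Longrightarrow> y \<in> mspace X \<Longrightarrow> mdist X x y \<le> D"
  shows "asdim_le X 0"
  unfolding asdim_le_iff_multiplicity
proof (intro allI impI exI conjI)
  show "uniformly_bounded_cover X {mspace X}"
    unfolding uniformly_bounded_cover_def
  proof (intro conjI exI[of _ D] ballI)
    show "mdist X x y \<le> D" if "U \<in> {mspace X}" "x \<in> U" "y \<in> U" for U x y
      using that by (intro assms) simp_all
  qed simp
  show "cover_multiplicity_le X R (0 + 1) {mspace X}" for R
    unfolding cover_multiplicity_le_def
  proof
    fix x
    let ?F = "{U\<in>{mspace X}. U \<inter> mball_of X x R \<noteq> {}}"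
    have F: "?F \<subseteq> {mspace X}" by blast
    have "card ?F \<le> card {mspace X}" by (rule card_mono[OF _ F]) simp
    then show "finite ?F \<and> card ?F \<le> 0 + 1" using finite_subset[OF F] by simp
  qed
qed

text \<open>A diagonal argument in the manner of Koenig: the pigeonhole principle gives a decreasing
  chain of infinite index sets \<open>I k\<close> on which \<open>F N k\<close> is constant in
  \<open>N\<close>. An index from \<open>I K\<close> agrees with the limit up to
  \<open>K\<close>.\<close>

lemma exists_locally_approximated_sequence:
  fixes F :: "nat \<Rightarrow> nat \<Rightarrow> 'b"
  assumes fin: "\<And>k. finite (B k)" and F: "\<And>N k. k \<le> N \<Longrightarrow> F N k \<in> B k"
  shows "\<exists>u. \<forall>K. \<exists>N\<ge>K. \<forall>k\<le>K. F N k = u k"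
proof -
  define P where "P k I \<longleftrightarrow> infinite I \<and> (\<forall>N\<in>I. k \<le> N) \<and> (\<exists>x. \<forall>N\<in>I. F N k = x)"
    for k and I :: "nat set"
  have refine: "\<exists>J\<subseteq>I. P k J" if I: "infinite I" for I k
  proof -
    \<comment> \<open>Indices below \<open>k\<close> are dropped, as \<open>F N k\<close> is known
      to lie in \<open>B k\<close> only for \<open>k \<le> N\<close>.\<close>
    let ?I = "I - {..<k}"
    have "infinite ?I" using I by simp
    moreover have "(\<lambda>N. F N k) ` ?I \<subseteq> B k" by (intro image_subsetI F) simp
    then have "finite ((\<lambda>N. F N k) ` ?I)" using fin by (rule finite_subset)
    ultimately have "\<exists>a\<in>?I. infinite {N\<in>?I. F N k = F a k}" by (rule pigeonhole_infinite)
    then obtain a where "infinite {N\<in>?I. F N k = F a k}" ..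
    moreover have "\<forall>N\<in>{N\<in>?I. F N k = F a k}. k \<le> N" by simp
    moreover have "\<exists>x. \<forall>N\<in>{N\<in>?I. F N k = F a k}. F N k = x" by (intro exI[of _ "F a k"]) simp
    ultimately have "P k {N\<in>?I. F N k = F a k}" unfolding P_def by (intro conjI)
    moreover have "{N\<in>?I. F N k = F a k} \<subseteq> I" by blast
    ultimately show ?thesis by (intro exI conjI)
  qed
  have "\<exists>I. \<forall>k. P k (I k) \<and> I (Suc k) \<subseteq> I k"
  proof (rule dependent_nat_choice)
    show "\<exists>I. P 0 I" using refine[of UNIV 0] by auto
    show "\<exists>J. P (Suc k) J \<and> J \<subseteq> I" if "P k I" for I k
    proof -
      have "infinite I" using that unfolding P_def by blast
      from refine[OF this, of "Suc k"] show ?thesis by blast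
    qed
  qed
  then obtain I where "\<forall>k. P k (I k) \<and> I (Suc k) \<subseteq> I k" ..
  then have I: "P k (I k)" "I (Suc k) \<subseteq> I k" for k by simp_all
  have anti: "I K \<subseteq> I k" if "k \<le> K" for k K
    using lift_Suc_antimono_le[of I, OF I(2) that] .
  have "\<exists>x. \<forall>N\<in>I k. F N k = x" for k using I(1)[of k] unfolding P_def by blast
  then obtain u where "\<forall>k. \<forall>N\<in>I k. F N k = u k" using choice[of "\<lambda>k x. \<forall>N\<in>I k. F N k = x"] by blast
  then have u: "F N k = u k" if "N \<in> I k" for N k using that by blast
  have "\<exists>N\<ge>K. \<forall>k\<le>K. F N k = u k" for K
  proof -
    have "I K \<noteq> {}" "\<forall>N\<in>I K. K \<le> N" using I(1)[of K] unfolding P_def by auto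
    then obtain N where "N \<in> I K" "K \<le> N" by blast
    then show ?thesis using u anti by blast
  qed
  then show ?thesis by blast
qed

section \<open>Walks and the word metric\<close>

locale generated_group = group G for G (structure) +
  fixes S
  assumes gen: "finite_generating_set G S"
begin

text \<open>In relational form, walks of length \<open>n\<close> are the elements of
  \<open>edges ^^ n\<close>.\<close>

abbreviation edges where "edges \<equiv> {(g, h). cayley_adj G S g h}"

lemma adj_carrier: "(a, b) \<in> edges \<Longrightarrow> a \<in> carrier G" "(a, b) \<in> edges \<Longrightarrow> b \<in> carrier G"
  by (auto simp: cayley_adj_def)

lemma adj_sym: "(a, b) \<in> edges \<Longrightarrow> (b, a) \<in> edges"
  by (auto simp: cayley_adj_def)

lemma walk_carrier: "(a, b) \<in> edges ^^ n \<Longrightarrow> a \<in> carrier G \<Longrightarrow> b \<in> carrier G"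
  by (induction n arbitrary: b) (auto simp: cayley_adj_def)

text \<open>Edges come from right multiplication by generators, which commutes with left
  translation.\<close>

lemma adj_translate:
  assumes "(a, b) \<in> edges" "c \<in> carrier G"
  shows "(c \<otimes> a, c \<otimes> b) \<in> edges"
proof -
  have ab: "a \<in> carrier G" "b \<in> carrier G" "a \<noteq> b" using assms by (auto simp: cayley_adj_def)
  obtain s where s: "s \<in> S" "b = a \<otimes> s \<or> a = b \<otimes> s" using assms by (auto simp: cayley_adj_def)
  have sG: "s \<in> carrier G" using s gen by (auto simp: finite_generating_set_def)
  have "c \<otimes> b = c \<otimes> a \<otimes> s \<or> c \<otimes> a = c \<otimes> b \<otimes> s"
    using s(2) sG ab assms(2) by (auto simp: m_assoc)
  then show ?thesis using ab s(1) assms(2) by (auto simp: cayley_adj_def)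
qed

lemma walk_translate:
  "(a, b) \<in> edges ^^ n \<Longrightarrow> c \<in> carrier G \<Longrightarrow> (c \<otimes> a, c \<otimes> b) \<in> edges ^^ n"
proof (induction n arbitrary: b)
  case (Suc n)
  then obtain d where "(a, d) \<in> edges ^^ n" "(d, b) \<in> edges" by auto
  then show ?case using Suc adj_translate by (blast intro: relpow_Suc_I)
qed auto

lemma walk_exists:
  assumes "a \<in> carrier G" "b \<in> carrier G"
  shows "\<exists>n. (a, b) \<in> edges ^^ n"
proof -
  have adj: "(g, h) \<in> edges\<^sup>*" if "g \<in> carrier G" "h \<in> carrier G" "\<exists>s\<in>S. h = g \<otimes> s \<or> g = h \<otimes> s" for g h
    using that by (cases "g = h") (auto simp: cayley_adj_def)
  have "(a, a \<otimes> w) \<in> edges\<^sup>*" if "w \<in> generate G S" "a \<in> carrier G" for w a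
    using that
  proof (induction arbitrary: a rule: generate.induct)
    case (incl s)
    then show ?case using gen by (intro adj) (auto simp: finite_generating_set_def)
  next
    case (inv s)
    then show ?case using gen
      by (intro adj bexI[of _ s]) (auto simp: m_assoc finite_generating_set_def)
  next
    case (eng u w)
    have uw: "u \<in> carrier G" "w \<in> carrier G"
      using eng.hyps gen unfolding finite_generating_set_def by blast+
    have "(a, a \<otimes> u) \<in> edges\<^sup>*" "(a \<otimes> u, a \<otimes> u \<otimes> w) \<in> edges\<^sup>*"
      using eng.IH eng.prems uw by simp_all
    then show ?case using eng.prems uw by (simp add: m_assoc)
  qed simp
  from this[of "inv a \<otimes> b" a] have "(a, b) \<in> edges\<^sup>*"
    using assms gen by (simp add: finite_generating_set_def m_assoc[symmetric])
  then show ?thesis by (rule rtrancl_imp_relpow)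
qed

text \<open>Local finiteness: a neighbour of \<open>g\<close> is \<open>g \<otimes> s\<close> or
  \<open>g \<otimes> inv s\<close>. All ends of walks of length \<open>n\<close> are counted, not
  only those of geodesics.\<close>

lemma finite_sphere: "a \<in> carrier G \<Longrightarrow> finite {b. (a, b) \<in> edges ^^ n}"
proof (induction n)
  case (Suc n)
  have "{h. cayley_adj G S g h} \<subseteq> (\<lambda>s. g \<otimes> s) ` S \<union> (\<lambda>s. g \<otimes> inv s) ` S" for g
  proof
    fix h assume "h \<in> {h. cayley_adj G S g h}"
    then obtain s where h: "g \<in> carrier G" "h \<in> carrier G" "s \<in> S" "h = g \<otimes> s \<or> g = h \<otimes> s"
      by (auto simp: cayley_adj_def)
    then have "s \<in> carrier G" using gen by (auto simp: finite_generating_set_def)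
    then have "h = g \<otimes> s \<or> h = g \<otimes> inv s" using h by (auto simp: m_assoc)
    then show "h \<in> (\<lambda>s. g \<otimes> s) ` S \<union> (\<lambda>s. g \<otimes> inv s) ` S" using h by blast
  qed
  moreover have "finite S" using gen by (simp add: finite_generating_set_def)
  ultimately have "finite {h. cayley_adj G S g h}" for g
    by (meson finite_Un finite_imageI finite_subset)
  then have "finite (\<Union>g\<in>{b. (a, b) \<in> edges ^^ n}. {h. cayley_adj G S g h})"
    using Suc by blast
  moreover have "{b. (a, b) \<in> edges ^^ Suc n} \<subseteq> (\<Union>g\<in>{b. (a, b) \<in> edges ^^ n}. {h. cayley_adj G S g h})"
    by auto
  ultimately show ?case using finite_subset by blast
qed simp

lemma walk_pl_path: "(a, b) \<in> edges ^^ n \<Longrightarrow> a \<in> carrier G \<Longrightarrow> pl_path G S (vertex_pt a) (real n) (vertex_pt b)"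
proof (induction n arbitrary: b)
  case 0
  then show ?case using pl_path.refl[of "vertex_pt a" G S] by (simp add: cayley_points_def)
next
  case (Suc n)
  then obtain c where c: "(a, c) \<in> edges ^^ n" "cayley_adj G S c b" by auto
  then have "c \<noteq> b" by (simp add: cayley_adj_def)
  then show ?case
    using pl_path.step[OF Suc.IH[OF c(1) Suc.prems(2)] c(2) vertex_pt_edge_seg]
    by (simp add: vertex_pt_def add.commute)
qed

text \<open>The word metric; for elements of the carrier the minimum exists by
  \<open>walk_exists\<close>.\<close>

definition graph_dist where "graph_dist a b = (LEAST n. (a, b) \<in> edges ^^ n)"

lemma graph_dist_walk: "a \<in> carrier G \<Longrightarrow> b \<in> carrier G \<Longrightarrow> (a, b) \<in> edges ^^ graph_dist a b"
  unfolding graph_dist_def using walk_exists by (rule LeastI_ex)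

lemma graph_dist_le: "(a, b) \<in> edges ^^ n \<Longrightarrow> graph_dist a b \<le> n"
  unfolding graph_dist_def by (rule Least_le)

lemma graph_dist_adj_le:
  assumes "a \<in> carrier G" "(g, h) \<in> edges"
  shows "graph_dist a h \<le> graph_dist a g + 1"
  using graph_dist_le[of a h "Suc (graph_dist a g)"] graph_dist_walk[of a g] assms adj_carrier
  by (metis Suc_eq_plus1 relpow_Suc_I)


section \<open>Comparison of the word metric with the path metric\<close>

text \<open>Points are given by barycentric coordinates, so the sum over the support extends
  \<open>f\<close> from the vertices affinely over each edge, without naming the edge.\<close>

definition affine_extension :: "('a \<Rightarrow> real) \<Rightarrow> ('a \<Rightarrow> real) \<Rightarrow> real" where
  "affine_extension f x = (\<Sum>v | x v \<noteq> 0. x v * f v)"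

lemma affine_extension_vertex: "affine_extension f (vertex_pt a) = f a"
proof -
  have "{v. vertex_pt a v \<noteq> 0} = {a}" by (auto simp: vertex_pt_def)
  then show ?thesis by (simp add: affine_extension_def vertex_pt_def)
qed

lemma affine_extension_edge:
  assumes "x \<in> edge_seg g h" "g \<noteq> h"
  shows "affine_extension f x = x g * f g + (1 - x g) * f h"
proof -
  obtain t where x: "x = (\<lambda>v. (1 - t) * vertex_pt g v + t * vertex_pt h v)"
    using assms unfolding edge_seg_def by auto
  have xgh: "x g = 1 - t" "x h = t" using x assms(2) by (auto simp: vertex_pt_def)
  have "x v = 0" if "v \<notin> {g, h}" for v using x that by (auto simp: vertex_pt_def)
  then have "{v. x v \<noteq> 0} \<subseteq> {g, h}" by blast
  then have "affine_extension f x = (\<Sum>v\<in>{g, h}. x v * f v)"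
    unfolding affine_extension_def by (intro sum.mono_neutral_left) auto
  then show ?thesis using assms(2) xgh by simp
qed

text \<open>On an edge the extension has slope \<open>f g - f h\<close> in the
  \<open>g\<close>-coordinate, so each piece of a path changes it by at most the length of that
  piece.\<close>

lemma affine_extension_Lipschitz:
  assumes lip: "\<And>g h. (g, h) \<in> edges \<Longrightarrow> \<bar>f g - f h\<bar> \<le> 1"
    and "pl_path G S x l y"
  shows "\<bar>affine_extension f x - affine_extension f y\<bar> \<le> l"
  using assms(2)
proof (induction rule: pl_path.induct)
  case (step x l y g h z)
  have "g \<noteq> h" using step.hyps by (simp add: cayley_adj_def)
  then have "affine_extension f y - affine_extension f z = (y g - z g) * (f g - f h)"
    using step.hyps by (simp add: affine_extension_edge algebra_simps)
  then have "\<bar>affine_extension f y - affine_extension f z\<bar> = \<bar>y g - z g\<bar> * \<bar>f g - f h\<bar>"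
    by (simp add: abs_mult)
  also have "\<dots> \<le> \<bar>y g - z g\<bar> * 1"
    using lip[of g h] step.hyps by (intro mult_left_mono) auto
  finally have "\<bar>affine_extension f y - affine_extension f z\<bar> \<le> \<bar>y g - z g\<bar>" by simp
  then show ?case using step.IH by linarith
qed simp

lemma cayley_dist_le: "pl_path G S x l y \<Longrightarrow> cayley_dist G S x y \<le> l"
proof -
  assume xy: "pl_path G S x l y"
  have "Inf {l. pl_path G S x l y} \<le> l"
    using xy pl_path_nonneg by (intro cInf_lower bdd_belowI[of _ 0]) auto
  then show ?thesis using pl_path_points[OF xy] by (simp add: cayley_dist_def)
qed

text \<open>The extension of the distance from \<open>a\<close> is 1-Lipschitz along paths, so no
  path has to be straightened into a walk, even if it turns back inside an edge.\<close>

lemma graph_dist_le_cayley_dist: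
  assumes "a \<in> carrier G" "b \<in> carrier G"
  shows "real (graph_dist a b) \<le> cayley_dist G S (vertex_pt a) (vertex_pt b)"
proof -
  have ab: "vertex_pt a \<in> cayley_points G S" "vertex_pt b \<in> cayley_points G S"
    using assms by (auto simp: cayley_points_def)
  let ?f = "\<lambda>v. real (graph_dist a v)"
  have lip: "\<bar>?f g - ?f h\<bar> \<le> 1" if "(g, h) \<in> edges" for g h
    using graph_dist_adj_le[OF assms(1) that] graph_dist_adj_le[OF assms(1) adj_sym[OF that]]
    by linarith
  have "graph_dist a a = 0" using graph_dist_le[of a a 0] by simp
  then have "real (graph_dist a b) \<le> l" if "pl_path G S (vertex_pt a) l (vertex_pt b)" for l
    using affine_extension_Lipschitz[of ?f, OF lip that] by (simp add: affine_extension_vertex)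
  moreover have "{l. pl_path G S (vertex_pt a) l (vertex_pt b)} \<noteq> {}"
    using pl_path_exists[OF is_group gen ab] by blast
  ultimately have "real (graph_dist a b) \<le> Inf {l. pl_path G S (vertex_pt a) l (vertex_pt b)}"
    by (intro cInf_greatest) auto
  then show ?thesis using ab by (simp add: cayley_dist_def)
qed

lemma near_vertex:
  assumes "x \<in> cayley_points G S"
  shows "\<exists>g\<in>carrier G. cayley_dist G S (vertex_pt g) x \<le> 1"
proof (cases "x \<in> vertex_pt ` carrier G")
  case True
  then obtain g where g: "g \<in> carrier G" "x = vertex_pt g" by blast
  then show ?thesis using cayley_dist_le[OF pl_path.refl[OF assms]] by force
next
  case False
  then obtain g h where gh: "cayley_adj G S g h" "x \<in> edge_seg g h"
    using assms unfolding cayley_points_def by auto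
  have "\<bar>vertex_pt g g - x g\<bar> \<le> 1"
    using gh by (auto simp: edge_seg_def vertex_pt_def cayley_adj_def)
  then have "cayley_dist G S (vertex_pt g) x \<le> 1"
    using cayley_dist_le[OF pl_path_edge[OF gh(1) vertex_pt_edge_seg(1) gh(2)]] by linarith
  then show ?thesis using gh by (auto simp: cayley_adj_def)
qed

section \<open>Geodesics of growing length and their limit\<close>

text \<open>Every point is within 1 of a vertex, so a bound \<open>N\<close> on the word metric
  would bound the graph by \<open>N + 2\<close> and give it dimension 0.\<close>

lemma graph_dist_unbounded:
  assumes "\<not> asdim_le (cayley_graph G S) 0"
  shows "\<exists>a\<in>carrier G. \<exists>b\<in>carrier G. N \<le> graph_dist a b"
proof (rule ccontr)
  assume "\<not> ?thesis"
  then have N: "graph_dist a b < N" if "a \<in> carrier G" "b \<in> carrier G" for a b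
    using that by (meson not_less)
  interpret M: Metric_space "cayley_points G S" "cayley_dist G S"
    by (rule Metric_space_cayley[OF is_group gen])
  have "cayley_dist G S x y \<le> real N + 2"
    if x: "x \<in> cayley_points G S" and y: "y \<in> cayley_points G S" for x y
  proof -
    obtain a b where a: "a \<in> carrier G" "cayley_dist G S (vertex_pt a) x \<le> 1"
      and b: "b \<in> carrier G" "cayley_dist G S (vertex_pt b) y \<le> 1"
      using near_vertex x y by meson
    have ab: "vertex_pt a \<in> cayley_points G S" "vertex_pt b \<in> cayley_points G S"
      using a b by (auto simp: cayley_points_def)
    have "cayley_dist G S (vertex_pt a) (vertex_pt b) \<le> real (graph_dist a b)"
      using a b by (intro cayley_dist_le walk_pl_path graph_dist_walk)
    then have "cayley_dist G S (vertex_pt a) (vertex_pt b) \<le> real N"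
      using N[of a b] a b by linarith
    then show ?thesis
      using M.triangle[OF x ab(1) y] M.triangle[OF ab y] a(2) b(2)
        M.commute[of x "vertex_pt a"] by linarith
  qed
  then have "asdim_le (cayley_graph G S) 0"
    by (intro asdim_le_0_of_bounded[of _ "real N + 2"]) (simp add: cayley_graph_simps[OF is_group gen])
  with assms show False ..
qed

text \<open>A geodesic of length at least \<open>2 * N\<close> is translated so that its
  \<open>N\<close>-th vertex becomes \<one>; \<open>u\<close> follows it forwards and
  \<open>v\<close> backwards.\<close>

lemma exists_centered_geodesic:
  assumes "\<not> asdim_le (cayley_graph G S) 0"
  shows "\<exists>u v. u 0 = \<one> \<and> v 0 = \<one> \<and>
     (\<forall>k<N. (u k, u (Suc k)) \<in> edges \<and> (v k, v (Suc k)) \<in> edges) \<and>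
     (\<forall>k\<le>N. \<forall>l\<le>N. k + l \<le> graph_dist (v k) (u l))"
proof -
  obtain a b where ab: "a \<in> carrier G" "b \<in> carrier G" "2 * N \<le> graph_dist a b"
    using graph_dist_unbounded[OF assms] by blast
  define n where "n = graph_dist a b"
  obtain f where f: "f 0 = a" "f n = b" "\<And>i. i < n \<Longrightarrow> (f i, f (Suc i)) \<in> edges"
    using graph_dist_walk[OF ab(1,2)] unfolding n_def relpow_fun_conv by blast
  have seg: "(f i, f (i + m)) \<in> edges ^^ m" if "i + m \<le> n" for i m
    unfolding relpow_fun_conv using that f(3) by (intro exI[of _ "\<lambda>j. f (i + j)"]) auto
  have fG: "f i \<in> carrier G" if "i \<le> n" for i
    using walk_carrier[of "f 0" "f (0 + i)" i] seg[of 0 i] that f(1) ab(1) by simp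
  \<comment> \<open>A shortcut between two vertices of the geodesic would shorten the whole walk
    from \<open>a\<close> to \<open>b\<close>.\<close>
  have geod: "j \<le> m" if m: "(f i, f (i + j)) \<in> edges ^^ m" and ij: "i + j \<le> n" for i j m
  proof -
    have "(f 0, f i) \<in> edges ^^ i" "(f (i + j), f n) \<in> edges ^^ (n - (i + j))"
      using seg[of 0 i] seg[of "i + j" "n - (i + j)"] ij by simp_all
    then have "(f 0, f n) \<in> edges ^^ (i + m + (n - (i + j)))"
      using m unfolding relpow_add by blast
    then have "n \<le> i + m + (n - (i + j))"
      unfolding f(1,2) using graph_dist_le[of a b] n_def by simp
    then show ?thesis using ij by linarith
  qed
  have N: "2 * N \<le> n" using ab(3) unfolding n_def .
  define c where "c = inv (f N)"
  have c: "c \<in> carrier G" "f N \<in> carrier G" unfolding c_def using fG[of N] N by auto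
  define u where "u k = c \<otimes> f (N + k)" for k
  define v where "v k = c \<otimes> f (N - k)" for k
  have "u 0 = \<one>" "v 0 = \<one>" using c unfolding u_def v_def c_def by simp_all
  moreover have "(u k, u (Suc k)) \<in> edges" if "k < N" for k
    unfolding u_def using f(3)[of "N + k"] that N c by (intro adj_translate) auto
  moreover have "(v k, v (Suc k)) \<in> edges" if "k < N" for k
  proof -
    have "(f (N - Suc k), f (Suc (N - Suc k))) \<in> edges" using that N by (intro f(3)) linarith
    then have "(f (N - k), f (N - Suc k)) \<in> edges" using that by (simp add: Suc_diff_Suc adj_sym[simplified])
    then show ?thesis unfolding v_def using c by (intro adj_translate)
  qed
  moreover have "k + l \<le> graph_dist (v k) (u l)" if kl: "k \<le> N" "l \<le> N" for k l
  proof -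
    have G: "f (N - k) \<in> carrier G" "f (N + l) \<in> carrier G" using kl N by (auto intro: fG)
    then have "(v k, u l) \<in> edges ^^ graph_dist (v k) (u l)"
      using c unfolding u_def v_def by (intro graph_dist_walk) auto
    from walk_translate[OF this c(2)] have "(f (N - k), f (N + l)) \<in> edges ^^ graph_dist (v k) (u l)"
      using G c unfolding u_def v_def c_def by (simp add: m_assoc[symmetric])
    then show ?thesis
      using geod[of "N - k" "k + l"] kl N by simp
  qed
  ultimately show ?thesis by blast
qed

text \<open>A limit of centered geodesics, which exists by local finiteness. Each required property
  involves finitely many indices and so is inherited from a long enough approximant.\<close>

lemma exists_bi_infinite_geodesic:
  assumes "\<not> asdim_le (cayley_graph G S) 0"
  shows "\<exists>u v. range u \<subseteq> carrier G \<and> range v \<subseteq> carrier G \<and>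
     (\<forall>k. (u k, u (Suc k)) \<in> edges) \<and> (\<forall>k l. k + l \<le> graph_dist (v k) (u l))"
proof -
  have "\<forall>N. \<exists>u v. u 0 = \<one> \<and> v 0 = \<one> \<and>
     (\<forall>k<N. (u k, u (Suc k)) \<in> edges \<and> (v k, v (Suc k)) \<in> edges) \<and>
     (\<forall>k\<le>N. \<forall>l\<le>N. k + l \<le> graph_dist (v k) (u l))"
    using exists_centered_geodesic[OF assms] by blast
  then obtain U V where UV: "\<And>N. U N 0 = \<one> \<and> V N 0 = \<one> \<and>
     (\<forall>k<N. (U N k, U N (Suc k)) \<in> edges \<and> (V N k, V N (Suc k)) \<in> edges) \<and>
     (\<forall>k\<le>N. \<forall>l\<le>N. k + l \<le> graph_dist (V N k) (U N l))"
    by metis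
  let ?B = "\<lambda>k. {b. (\<one>, b) \<in> edges ^^ k}"
  \<comment> \<open>Pairing the two halves makes both limits agree with the same approximating
    geodesic.\<close>
  have "(U N k, V N k) \<in> ?B k \<times> ?B k" if "k \<le> N" for N k
    using that
  proof (induction k)
    case (Suc k)
    then have "(\<one>, U N k) \<in> edges ^^ k" "(\<one>, V N k) \<in> edges ^^ k"
      "(U N k, U N (Suc k)) \<in> edges" "(V N k, V N (Suc k)) \<in> edges"
      using UV[of N] by simp_all
    then show ?case by (blast intro: relpow_Suc_I)
  qed (use UV in simp)
  moreover have "finite (?B k \<times> ?B k)" for k using finite_sphere by simp
  ultimately obtain w where w: "\<And>K. \<exists>N\<ge>K. \<forall>k\<le>K. (U N k, V N k) = w k"
    using exists_locally_approximated_sequence[where B = "\<lambda>k. ?B k \<times> ?B k" and F = "\<lambda>N k. (U N k, V N k)"]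
    by metis
  define u where "u = (\<lambda>k. fst (w k))"
  define v where "v = (\<lambda>k. snd (w k))"
  have approx: "\<exists>N\<ge>K. \<forall>k\<le>K. U N k = u k \<and> V N k = v k" for K
    using w[of K] unfolding u_def v_def by (metis fst_conv snd_conv)
  have "(u k, u (Suc k)) \<in> edges" for k
  proof -
    obtain N where "N \<ge> Suc k" "U N k = u k" "U N (Suc k) = u (Suc k)"
      using approx[of "Suc k"] by (meson le_SucI order_refl)
    then show ?thesis using UV[of N] by (metis Suc_le_lessD)
  qed
  moreover have "k + l \<le> graph_dist (v k) (u l)" for k l
  proof -
    obtain N where "N \<ge> k + l" "V N k = v k" "U N l = u l"
      using approx[of "k + l"] by (meson le_add1 le_add2)
    then show ?thesis using UV[of N] by (metis add_leD1 add_leD2)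
  qed
  moreover have "u k \<in> carrier G \<and> v k \<in> carrier G" for k
  proof -
    obtain N where "N \<ge> k" "V N k = v k" "U N k = u k"
      using approx[of k] by blast
    then have "(\<one>, u k) \<in> edges ^^ k" "(\<one>, v k) \<in> edges ^^ k"
      using \<open>\<And>N k. k \<le> N \<Longrightarrow> (U N k, V N k) \<in> ?B k \<times> ?B k\<close>[of k N] by simp_all
    then show ?thesis using walk_carrier one_closed by blast
  qed
  ultimately show ?thesis by blast
qed

section \<open>Connected rays and the separating set\<close>

text \<open>The barycentric parametrization by the unit interval is 1-Lipschitz, hence continuous
  for the graph metric.\<close>

lemma connectedin_edge_seg:
  assumes gh: "cayley_adj G S g h"
  shows "connectedin (mtopology_of (cayley_graph G S)) (edge_seg g h)"
proof -
  let ?X = "cayley_graph G S" and ?I = "submetric euclidean_metric {0..1::real}"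
  define e where "e t = (\<lambda>v. (1 - t) * vertex_pt g v + t * vertex_pt h v)" for t
  have seg: "edge_seg g h = e ` {0..1}" unfolding edge_seg_def e_def by blast
  have "g \<noteq> h" using gh by (simp add: cayley_adj_def)
  have "Lipschitz_continuous_map ?I ?X e"
    unfolding Lipschitz_continuous_map_def
  proof (intro conjI exI[of _ 1] ballI)
    show "e \<in> mspace ?I \<rightarrow> mspace ?X"
      using edge_seg_points[OF gh] seg by (auto simp: cayley_graph_simps[OF is_group gen])
    fix s t :: real assume "s \<in> mspace ?I" "t \<in> mspace ?I"
    then have "e s \<in> edge_seg g h" "e t \<in> edge_seg g h" using seg by auto
    from cayley_dist_le[OF pl_path_edge[OF gh this]]
    have "cayley_dist G S (e s) (e t) \<le> \<bar>e s g - e t g\<bar>" .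
    also have "\<dots> = dist s t" using \<open>g \<noteq> h\<close> by (simp add: e_def vertex_pt_def dist_real_def)
    finally show "mdist ?X (e s) (e t) \<le> 1 * mdist ?I s t"
      by (simp add: cayley_graph_simps[OF is_group gen])
  qed
  then have "continuous_map (mtopology_of ?I) (mtopology_of ?X) e"
    by (rule Lipschitz_continuous_imp_continuous_map)
  moreover have "connectedin (mtopology_of ?I) {0..1}"
    by (simp add: mtopology_of_submetric connectedin_subtopology)
  ultimately show ?thesis unfolding seg by (rule connectedin_continuous_map_image)
qed

text \<open>Consecutive edges share a vertex, and all finite initial parts share the first
  one.\<close>

lemma connectedin_ray:
  assumes u: "\<And>k. (u k, u (Suc k)) \<in> edges"
  shows "connectedin (mtopology_of (cayley_graph G S)) (\<Union>k. edge_seg (u k) (u (Suc k)))"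
proof -
  let ?e = "\<lambda>k. edge_seg (u k) (u (Suc k))"
  have "connectedin (mtopology_of (cayley_graph G S)) (\<Union>k\<le>n. ?e k)" for n
  proof (induction n)
    case 0
    then show ?case using connectedin_edge_seg u by simp
  next
    case (Suc n)
    have "vertex_pt (u (Suc n)) \<in> (\<Union>k\<le>n. ?e k) \<inter> ?e (Suc n)"
      using vertex_pt_edge_seg(2)[of "u (Suc n)" "u n"] vertex_pt_edge_seg(1)[of "u (Suc n)" "u (Suc (Suc n))"]
      by blast
    then have "connectedin (mtopology_of (cayley_graph G S)) ((\<Union>k\<le>n. ?e k) \<union> ?e (Suc n))"
      using Suc connectedin_edge_seg u by (intro connectedin_Un) auto
    moreover have "(\<Union>k\<le>Suc n. ?e k) = (\<Union>k\<le>n. ?e k) \<union> ?e (Suc n)"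
      by (auto simp: atMost_Suc)
    ultimately show ?case by simp
  qed
  moreover have "vertex_pt (u 0) \<in> (\<Union>k\<le>n. ?e k)" for n
    using vertex_pt_edge_seg(1)[of "u 0" "u (Suc 0)"] by blast
  then have "\<Inter>(range (\<lambda>n. \<Union>k\<le>n. ?e k)) \<noteq> {}" by blast
  ultimately have "connectedin (mtopology_of (cayley_graph G S)) (\<Union>(range (\<lambda>n. \<Union>k\<le>n. ?e k)))"
    by (intro connectedin_Union) auto
  moreover have "\<Union>(range (\<lambda>n. \<Union>k\<le>n. ?e k)) = (\<Union>k. ?e k)" by blast
  ultimately show ?thesis by simp
qed

lemma exists_separating_set:
  assumes asd: "asdim_le (cayley_graph G S) n" and not0: "\<not> asdim_le (cayley_graph G S) 0"
  shows "\<exists>Y\<subseteq>mspace (cayley_graph G S). weakly_coarsely_separates (cayley_graph G S) Y \<and>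
             asdim_le (submetric (cayley_graph G S) Y) (n - 1)"
proof -
  interpret M: Metric_space "cayley_points G S" "cayley_dist G S"
    by (rule Metric_space_cayley[OF is_group gen])
  note X = cayley_graph_simps[OF is_group gen]
  obtain u v where uv: "range u \<subseteq> carrier G" "range v \<subseteq> carrier G"
    and u: "\<forall>k. (u k, u (Suc k)) \<in> edges" and far: "\<forall>k l. k + l \<le> graph_dist (v k) (u l)"
    using exists_bi_infinite_geodesic[OF not0] by (elim exE conjE)
  have uvG: "u k \<in> carrier G" "v k \<in> carrier G" for k using uv by auto
  then have pts: "vertex_pt (u k) \<in> cayley_points G S" "vertex_pt (v k) \<in> cayley_points G S" for k
    unfolding cayley_points_def by blast+
  have dist_vu: "real k + real l \<le> cayley_dist G S (vertex_pt (v k)) (vertex_pt (u l))" for k l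
    using graph_dist_le_cayley_dist[OF uvG(2)[of k] uvG(1)[of l]] far[rule_format, of k l] by linarith
  \<comment> \<open>A point of the \<open>k\<close>-th edge is within 1 of \<open>u (k + 3)\<close>,
    so starting at index 3 leaves a distance of at least \<open>i + 2\<close> from
    \<open>v i\<close>.\<close>
  let ?Q = "\<Union>k. edge_seg (u (k + 3)) (u (Suc k + 3))"
  have u3: "(u (k + 3), u (Suc k + 3)) \<in> edges" for k using u[rule_format, of "k + 3"] by simp
  have "real i + 2 \<le> cayley_dist G S (vertex_pt (v i)) z" if zQ: "z \<in> ?Q" for i z
  proof -
    obtain k where k: "z \<in> edge_seg (u (k + 3)) (u (Suc k + 3))" using zQ by blast
    have adj: "cayley_adj G S (u (k + 3)) (u (Suc k + 3))" using u3[of k] by simp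
    have z: "z \<in> cayley_points G S" using edge_seg_points[OF adj] k by blast
    have "0 \<le> z (u (k + 3)) \<and> z (u (k + 3)) \<le> 1"
      using k by (auto simp: edge_seg_def vertex_pt_def)
    then have "\<bar>z (u (k + 3)) - vertex_pt (u (k + 3)) (u (k + 3))\<bar> \<le> 1"
      by (simp add: vertex_pt_def)
    then have "cayley_dist G S z (vertex_pt (u (k + 3))) \<le> 1"
      using cayley_dist_le[OF pl_path_edge[OF adj k vertex_pt_edge_seg(1)]] by linarith
    then show ?thesis
      using dist_vu[of i "k + 3"] M.triangle[OF pts(2) z pts(1), of i "k + 3"] by simp
  qed
  moreover have "vertex_pt (u (m + 3)) \<in> ?Q" for m
    using vertex_pt_edge_seg(1)[of "u (m + 3)" "u (Suc m + 3)"] by blast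
  moreover have "real i + real m \<le> cayley_dist G S (vertex_pt (v i)) (vertex_pt (u (m + 3)))" for i m
    using dist_vu[of i "m + 3"] by simp
  moreover have "connectedin (mtopology_of (cayley_graph G S)) ?Q"
    using connectedin_ray[of "\<lambda>k. u (k + 3)", OF u3] .
  moreover have "1 \<le> n" using asd not0 by (cases n) auto
  ultimately show ?thesis
    using exists_separating_set_of_smaller_asdim[of "cayley_graph G S" n "\<lambda>i. vertex_pt (v i)" ?Q "\<lambda>m. vertex_pt (u (m + 3))"]
      asd pts(2) unfolding X by blast
qed

end

theorem theorem1p2:
  fixes G :: "('a, 'b) monoid_scheme"
  assumes "group G"
    and "finitely_generated G"
    and "0 < group_asdim G"
    and "group_asdim G < \<infinity>"
  shows "\<exists>S Y. finite_generating_set G S \<and>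
           Y \<subseteq> mspace (cayley_graph G S) \<and>
           weakly_coarsely_separates (cayley_graph G S) Y \<and>
           asdim (submetric (cayley_graph G S) Y) < group_asdim G"
proof -
  \<comment> \<open>This is the very choice made in \<open>group_asdim\<close>, so both dimensions
    refer to the same graph.\<close>
  define S where "S = (SOME S. finite_generating_set G S)"
  have S: "finite_generating_set G S"
    using assms(2) unfolding finitely_generated_def S_def by (rule someI_ex)
  interpret group G by fact
  interpret generated_group G S by unfold_locales (fact S)
  have dim: "group_asdim G = asdim (cayley_graph G S)" unfolding group_asdim_def S_def ..
  obtain n where n: "asdim (cayley_graph G S) = enat n"
    using assms(4) dim by (cases "asdim (cayley_graph G S)") auto
  then have "0 < n" using assms(3) dim by (simp add: zero_enat_def)
  have "asdim_le (cayley_graph G S) n" "\<not> asdim_le (cayley_graph G S) 0"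
    using n \<open>0 < n\<close> asdim_le_iff[of "cayley_graph G S" n] asdim_le_iff[of "cayley_graph G S" 0]
    by simp_all
  then obtain Y where Y: "Y \<subseteq> mspace (cayley_graph G S)"
    "weakly_coarsely_separates (cayley_graph G S) Y"
    "asdim_le (submetric (cayley_graph G S) Y) (n - 1)"
    using exists_separating_set by blast
  have "asdim (submetric (cayley_graph G S) Y) \<le> enat (n - 1)"
    using Y(3) by (simp add: asdim_le_iff)
  also have "\<dots> < group_asdim G" using n dim \<open>0 < n\<close> by simp
  finally show ?thesis using S Y(1,2) by blast
qed

end
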